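(* Let $f:\mathbb R\to\mathbb R$ be smooth with $f_{uu}=\beta f$ for a real constant $\beta\ne0$, and suppose that $f$ does not satisfy a (linear) first-order ODE, i.e. $f$ and $f_u$ are linearly independent over $\mathbb R$. Then $\dim_{\mathbb C}V_d=1$ for all odd integers $d$.
   Context: Subscripts such as $f_u$, $P_{u_i}$ denote partial derivatives; bars denote complex conjugation. The functions live on the infinite jet space $M^{(\infty)}$ with complex coordinates $z,u_0,u_1,u_2,\dots$ and real coordinate $u$ (each smooth function depends on finitely many coordinates). Put $T^0=f(u)$, $T^{i+1}=\sum_{j=0}^{i}\binom ij u_{i-j}\,T^j_u$, and $e_{-1}=\partial_z+u_0\partial_u+\sum_{i\ge0}u_{i+1}\partial_{u_i}-\sum_{i\ge0}\overline{T^i}\,\partial_{\bar u_i}$, $e_{\overline{-1}}=\overline{e_{-1}}$. A complex function $P$ has weighted degree $d\in\mathbb Z$ if $P(u,\lambda^{-1}z,(\lambda^{j+1}u_j)_j)=\lambda^dP(u,z,(u_j)_j)$ for all $\lambda\in\mathbb C$ with $|\lambda|=1$. $V_d$ is the complex vector space of complex-valued functions $P$ on $M^{(\infty)}$ of weighted degree $d$ satisfying $e_{\overline{-1}}e_{-1}P+f_uP=0$, $P_u=0$ and $P_{u_i\bar u_j}=0$ for all $i,j\ge0$. *)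

theory Defs
  imports "HOL-Analysis.Analysis" "HOL-Library.Function_Algebras"
begin

text \<open>A point \<open>(z, u, p)\<close> of the infinite jet space; \<open>p i\<close> is the coordinate \<open>u\<^sub>i\<close>.\<close>

type_synonym jet = "complex \<times> real \<times> (nat \<Rightarrow> complex)"

datatype real_coord = Re_z | Im_z | U | Re_u nat | Im_u nat

fun translate :: "real_coord \<Rightarrow> real \<Rightarrow> jet \<Rightarrow> jet" where
  "translate Re_z t (z, u, p) = (z + of_real t, u, p)"
| "translate Im_z t (z, u, p) = (z + \<i> * of_real t, u, p)"
| "translate U t (z, u, p) = (z, u + t, p)"
| "translate (Re_u i) t (z, u, p) = (z, u, p(i := p i + of_real t))"
| "translate (Im_u i) t (z, u, p) = (z, u, p(i := p i + \<i> * of_real t))"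

definition pd :: "real_coord \<Rightarrow> (jet \<Rightarrow> complex) \<Rightarrow> jet \<Rightarrow> complex" where
  "pd c P x = vector_derivative (\<lambda>t. P (translate c t x)) (at 0)"

definition finitely_many_coords :: "(jet \<Rightarrow> complex) \<Rightarrow> bool" where
  "finitely_many_coords P \<longleftrightarrow>
     (\<exists>n. \<forall>z u p q. (\<forall>i<n. p i = q i) \<longrightarrow> P (z, u, p) = P (z, u, q))"

text \<open>All iterated partial derivatives, in any order, exist and are continuous. Continuity refers
  to the product topology on \<open>nat \<Rightarrow> complex\<close>; for a function of finitely many coordinates it
  coincides with continuity in these coordinates.\<close>

definition smooth_jet :: "(jet \<Rightarrow> complex) \<Rightarrow> bool" where
  "smooth_jet P \<longleftrightarrow> finitely_many_coords P \<and>
     (\<forall>cs. continuous_on UNIV (foldr pd cs P) \<and>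
        (\<forall>c x. (\<lambda>t. foldr pd cs P (translate c t x)) differentiable at 0))"

text \<open>Wirtinger derivatives with respect to \<open>z\<close>, \<open>u\<^sub>i\<close> and the conjugate of \<open>u\<^sub>i\<close>.\<close>

definition pd_z :: "(jet \<Rightarrow> complex) \<Rightarrow> jet \<Rightarrow> complex" where
  "pd_z P x = (pd Re_z P x - \<i> * pd Im_z P x) / 2"

definition pd_u :: "nat \<Rightarrow> (jet \<Rightarrow> complex) \<Rightarrow> jet \<Rightarrow> complex" where
  "pd_u i P x = (pd (Re_u i) P x - \<i> * pd (Im_u i) P x) / 2"

definition pd_ubar :: "nat \<Rightarrow> (jet \<Rightarrow> complex) \<Rightarrow> jet \<Rightarrow> complex" where
  "pd_ubar i P x = (pd (Re_u i) P x + \<i> * pd (Im_u i) P x) / 2"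

fun T :: "(real \<Rightarrow> real) \<Rightarrow> nat \<Rightarrow> jet \<Rightarrow> complex" where
  "T f 0 = (\<lambda>(z, u, p). of_real (f u))"
| "T f (Suc i) = (\<lambda>(z, u, p). \<Sum>j\<in>{..i}. of_nat (i choose j) * p (i - j) * pd U (T f j) (z, u, p))"

text \<open>The vector field \<open>e\<^sub>-\<^sub>1\<close>. On a function of finitely many coordinates only finitely
  many terms of the two series are nonzero.\<close>

fun e_minus :: "(real \<Rightarrow> real) \<Rightarrow> (jet \<Rightarrow> complex) \<Rightarrow> jet \<Rightarrow> complex" where
  "e_minus f P (z, u, p) =
     pd_z P (z, u, p) + p 0 * pd U P (z, u, p)
     + (\<Sum>i. p (Suc i) * pd_u i P (z, u, p))
     - (\<Sum>i. cnj (T f i (z, u, p)) * pd_ubar i P (z, u, p))"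

text \<open>The conjugate of a complex vector field \<open>X\<close> acts by \<open>P \<mapsto> cnj (X (cnj P))\<close>.\<close>

definition e_minus_bar :: "(real \<Rightarrow> real) \<Rightarrow> (jet \<Rightarrow> complex) \<Rightarrow> jet \<Rightarrow> complex" where
  "e_minus_bar f P x = cnj (e_minus f (\<lambda>y. cnj (P y)) x)"

definition weighted_degree :: "int \<Rightarrow> (jet \<Rightarrow> complex) \<Rightarrow> bool" where
  "weighted_degree d P \<longleftrightarrow>
     (\<forall>z u p l. cmod l = 1 \<longrightarrow>
        P (inverse l * z, u, \<lambda>j. l ^ (j + 1) * p j) = l powi d * P (z, u, p))"

definition V :: "(real \<Rightarrow> real) \<Rightarrow> int \<Rightarrow> (jet \<Rightarrow> complex) set" where
  "V f d = {P. smooth_jet P \<and> weighted_degree d P \<and>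
     (\<forall>z u p. e_minus_bar f (e_minus f P) (z, u, p) + of_real (deriv f u) * P (z, u, p) = 0) \<and>
     (\<forall>x. pd U P x = 0) \<and>
     (\<forall>i j x. pd_ubar j (pd_u i P) x = 0)}"

definition jet_scale :: "complex \<Rightarrow> (jet \<Rightarrow> complex) \<Rightarrow> jet \<Rightarrow> complex" where
  "jet_scale c P = (\<lambda>x. c * P x)"

interpretation jet_fun: vector_space jet_scale
  by unfold_locales (auto simp: jet_scale_def fun_eq_iff algebra_simps)

definition smooth_real :: "(real \<Rightarrow> real) \<Rightarrow> bool" where
  "smooth_real f \<longleftrightarrow> (\<forall>n x. (deriv ^^ n) f differentiable at x)"

end

(* Existence.  Put T^i = a_i f + b_i f_u.  With D = sum u_{i+1} d/du_i, w^2 = beta and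
   X_w = sum (a_i + w b_i) d/du_i one has X_w D = (D + w u_0) X_w, and a polynomial A in the u_i
   solves the equation iff X_w D A = w A and X_{-w} D A = -w A.  The Miura transform
   q = w u_1 - (w u_0)^2 / 2 is annihilated by X_w, hence so is every K in C[q, Dq, ...], and then
   A = (D + w u_0) K satisfies the first condition.  If K runs through the Lenard recursion of KdV,
   A is odd under w -> -w, which gives the second condition.

   Uniqueness.  As 1, f, f_u are linearly independent, the equation splits into three equations free
   of u.  Expanded at u_i = 0, their lowest-order terms force a solution to vanish as soon as its
   linear part in the u_i and in their conjugates does: a homogeneous part A of degree at least 2
   satisfies d/du_0 A = 0 and D S A = A with S = sum u_{i-1} d/du_i, whence d/du_k A = 0 for all k by
   induction.  The weight leaves a single constant in the linear part. *)

theory Submission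
  imports Defs "HOL-Complex_Analysis.Complex_Analysis"
begin

section \<open>Smooth functions on the jet space\<close>

text \<open>Two points carry the weight. Oddness of A in w rests on the factorisation D^3 + 2 q D +
  q' = (D - v) D (D + v) with v = w u_0 and q = v' - v^2 / 2: replacing w by -w exchanges the outer
  factors, so the Lenard chains for w and -w can be compared step by step. The comparison integrates
  once, which is harmless because D has no kernel in positive weight. The fields X_w arise from T^i
  = (D + u_0 d/du)^i f: for f = exp(w u), division by f leaves a_i + w b_i = (D + w u_0)^i 1. If
  \<beta> < 0, then w is imaginary, so the algebra is done over the complex numbers. Uniqueness
  concerns functions that are merely smooth and may depend on z. The condition on mixed derivatives
  makes every d/du_i P holomorphic in the u_j, so vanishing to infinite order at u_j = 0 is enough.
  Dependence on z in the linear part cannot be excluded by the equation alone: z u_0 minus its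
  conjugate, the infinitesimal rotation, is a solution. It has weight 0, and this is where d being
  nonzero enters.\<close>

lemma translate_0 [simp]: "translate c 0 x = x"
  by (cases c; cases x) auto

lemma translate_add: "translate c s (translate c t x) = translate c (s + t) x"
  by (cases c; cases x) (auto simp: algebra_simps)

lemma translate_commute: "translate c s (translate c' t x) = translate c' t (translate c s x)"
  by (cases c; cases c'; cases x) (auto simp: fun_upd_def fun_eq_iff)

lemma continuous_on_translate:
  fixes g :: "'a::topological_space \<Rightarrow> jet"
  assumes g: "continuous_on S g" and h: "continuous_on S h"
  shows "continuous_on S (\<lambda>s. translate c (h s) (g s))"
proof -
  have z: "continuous_on S (\<lambda>s. fst (g s))" and u: "continuous_on S (\<lambda>s. fst (snd (g s)))"
    and p: "continuous_on S (\<lambda>s. snd (snd (g s)))"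
    by (intro continuous_on_fst continuous_on_snd g)+
  have p': "continuous_on S (\<lambda>s. snd (snd (g s)) i)" for i
    by (rule continuous_on_product_then_coordinatewise[OF p])
  have q: "continuous_on S (\<lambda>s j. snd (snd (g s)) j + w * of_real (h s) * (if j = i then 1 else 0))" for i w
    by (rule continuous_on_coordinatewise_then_product) (intro continuous_intros p' h)
  have "translate c (h s) (g s) =
     (case c of Re_z \<Rightarrow> (fst (g s) + of_real (h s), fst (snd (g s)), snd (snd (g s)))
      | Im_z \<Rightarrow> (fst (g s) + \<i> * of_real (h s), fst (snd (g s)), snd (snd (g s)))
      | U \<Rightarrow> (fst (g s), fst (snd (g s)) + h s, snd (snd (g s)))
      | Re_u i \<Rightarrow> (fst (g s), fst (snd (g s)), \<lambda>j. snd (snd (g s)) j + 1 * of_real (h s) * (if j = i then 1 else 0))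
      | Im_u i \<Rightarrow> (fst (g s), fst (snd (g s)), \<lambda>j. snd (snd (g s)) j + \<i> * of_real (h s) * (if j = i then 1 else 0)))" for s
    by (cases c; cases "g s") (simp_all add: fun_eq_iff)
  then show ?thesis
    by (cases c) (simp_all only: real_coord.case, (intro continuous_on_Pair z u p q continuous_intros h)+)
qed

text \<open>Coordinate lines are orbits of a flow, so \<open>pd\<close>, defined at parameter 0
  only, yields the derivative along the whole line. This is what integration along such a line
  requires.\<close>

lemma vector_derivative_translate:
  "pd c P (translate c t x) = vector_derivative (\<lambda>s. P (translate c s x)) (at t)"
proof -
  have "((\<lambda>s. P (translate c s (translate c t x))) has_vector_derivative D) (at 0) \<longleftrightarrow>
        ((\<lambda>s. P (translate c s x)) has_vector_derivative D) (at t)" for D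
  proof -
    have "((\<lambda>s. P (translate c s (translate c t x))) has_vector_derivative D) (at 0) \<longleftrightarrow>
      (((\<lambda>s. P (translate c s x)) \<circ> (\<lambda>s. s + t)) has_vector_derivative D) (at 0)"
      by (simp add: translate_add o_def)
    also have "\<dots> \<longleftrightarrow> ((\<lambda>s. P (translate c s x)) has_vector_derivative D) (at t)"
    proof
      assume A: "(((\<lambda>s. P (translate c s x)) \<circ> (\<lambda>s. s + t)) has_vector_derivative D) (at 0)"
      have B: "((\<lambda>s. s - t) has_vector_derivative 1) (at t)"
        by (auto intro!: derivative_eq_intros)
      have "((((\<lambda>s. P (translate c s x)) \<circ> (\<lambda>s. s + t)) \<circ> (\<lambda>s. s - t)) has_vector_derivative (1 *\<^sub>R D)) (at t)"
        by (rule vector_diff_chain_at[OF B]) (use A in simp)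
      then show "((\<lambda>s. P (translate c s x)) has_vector_derivative D) (at t)" by (simp add: o_def)
    next
      assume A: "((\<lambda>s. P (translate c s x)) has_vector_derivative D) (at t)"
      have B: "((\<lambda>s. s + t) has_vector_derivative 1) (at 0)"
        by (auto intro!: derivative_eq_intros)
      have "(((\<lambda>s. P (translate c s x)) \<circ> (\<lambda>s. s + t)) has_vector_derivative (1 *\<^sub>R D)) (at 0)"
        by (rule vector_diff_chain_at[OF B]) (use A in simp)
      then show "(((\<lambda>s. P (translate c s x)) \<circ> (\<lambda>s. s + t)) has_vector_derivative D) (at 0)" by simp
    qed
    finally show ?thesis .
  qed
  then show ?thesis
    unfolding pd_def vector_derivative_def by simp
qed

definition pdiff :: "real_coord \<Rightarrow> (jet \<Rightarrow> complex) \<Rightarrow> bool" where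
  "pdiff c P \<longleftrightarrow> (\<forall>x. (\<lambda>t. P (translate c t x)) differentiable at 0)"

lemma pdiff_has_derivative:
  assumes "pdiff c P"
  shows "((\<lambda>s. P (translate c s x)) has_vector_derivative pd c P (translate c t x)) (at t)"
proof -
  have "(\<lambda>s. P (translate c s (translate c t x))) differentiable at 0"
    using assms unfolding pdiff_def by blast
  then have "(\<lambda>s. P (translate c (s + t) x)) differentiable at 0"
    by (simp add: translate_add)
  moreover have "(\<lambda>s. s - t) differentiable at t" by simp
  ultimately have "((\<lambda>s. P (translate c (s + t) x)) \<circ> (\<lambda>s. s - t)) differentiable at t"
    by (intro differentiable_chain_at) auto
  then have "(\<lambda>s. P (translate c s x)) differentiable at t"
    by (simp add: o_def)
  then show ?thesis
    unfolding vector_derivative_translate by (rule vector_derivative_works[THEN iffD1])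
qed

lemma pdiff_has_derivative_0:
  "pdiff c P \<Longrightarrow> ((\<lambda>s. P (translate c s x)) has_vector_derivative pd c P x) (at 0)"
  using pdiff_has_derivative[of c P x 0] by simp

lemma pdI:
  assumes "\<And>x. ((\<lambda>s. P (translate c s x)) has_vector_derivative Q x) (at 0)"
  shows "pdiff c P" "pd c P = Q"
  using assms
  by (auto simp: pdiff_def pd_def fun_eq_iff vector_derivative_at
      intro: differentiableI_vector)

text \<open>Coinduction for smoothness: one class containing P and closed under all partial
  derivatives suffices.\<close>

lemma smooth_jetI:
  assumes "P \<in> S"
    and "\<And>Q. Q \<in> S \<Longrightarrow> finitely_many_coords Q"
    and "\<And>Q. Q \<in> S \<Longrightarrow> continuous_on UNIV Q"
    and "\<And>Q c. Q \<in> S \<Longrightarrow> pdiff c Q"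
    and "\<And>Q c. Q \<in> S \<Longrightarrow> pd c Q \<in> S"
  shows "smooth_jet P"
proof -
  have "foldr pd cs P \<in> S" for cs
    by (induction cs) (auto intro: assms)
  then show ?thesis
    using assms unfolding smooth_jet_def pdiff_def by blast
qed

lemma smooth_jetD:
  assumes "smooth_jet P"
  shows "finitely_many_coords P" "continuous_on UNIV P" "pdiff c P"
proof -
  have "continuous_on UNIV (foldr pd [] P)" "(\<lambda>t. foldr pd [] P (translate c t x)) differentiable at 0" for x
    using assms unfolding smooth_jet_def by blast+
  then show "continuous_on UNIV P" "pdiff c P" by (auto simp: pdiff_def)
qed (use assms in \<open>simp add: smooth_jet_def\<close>)

lemma finitely_many_coordsI:
  assumes "\<And>z u p q. (\<And>i. i < n \<Longrightarrow> p i = q i) \<Longrightarrow> P (z, u, p) = P (z, u, q)"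
  shows "finitely_many_coords P"
  using assms unfolding finitely_many_coords_def by blast

lemma finitely_many_coords_pd:
  assumes "finitely_many_coords P"
  shows "finitely_many_coords (pd c P)"
proof -
  obtain n where n: "\<And>z u p q. (\<forall>i<n. p i = q i) \<Longrightarrow> P (z, u, p) = P (z, u, q)"
    using assms unfolding finitely_many_coords_def by metis
  show ?thesis
  proof (rule finitely_many_coordsI[of n])
    fix z u p q assume pq: "\<And>i. i < n \<Longrightarrow> p i = (q i :: complex)"
    have "P (translate c t (z, u, p)) = P (translate c t (z, u, q))" for t
      using pq by (cases c) (auto intro!: n)
    then show "pd c P (z, u, p) = pd c P (z, u, q)" by (simp add: pd_def)
  qed
qed

lemma smooth_jet_pd:
  assumes "smooth_jet P"
  shows "smooth_jet (pd c P)"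
proof -
  have "foldr pd cs (pd c P) = foldr pd (cs @ [c]) P" for cs by simp
  then show ?thesis
    using assms finitely_many_coords_pd unfolding smooth_jet_def by metis
qed

section \<open>Closure of smooth functions under ring operations, and basic examples\<close>

lemma finitely_many_coords_op:
  assumes "finitely_many_coords P" "finitely_many_coords Q"
  shows "finitely_many_coords (\<lambda>x. h (P x) (Q x))"
proof -
  obtain m where m: "\<And>z u p q. (\<forall>i<m. p i = q i) \<Longrightarrow> P (z, u, p) = P (z, u, q)"
    using assms(1) unfolding finitely_many_coords_def by metis
  obtain n where n: "\<And>z u p q. (\<forall>i<n. p i = q i) \<Longrightarrow> Q (z, u, p) = Q (z, u, q)"
    using assms(2) unfolding finitely_many_coords_def by metis
  show ?thesis
  proof (rule finitely_many_coordsI[of "max m n"])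
    fix z u p q assume pq: "\<And>i. i < max m n \<Longrightarrow> p i = (q i :: complex)"
    have "P (z, u, p) = P (z, u, q)" "Q (z, u, p) = Q (z, u, q)"
      using pq by (auto intro!: m n)
    then show "h (P (z, u, p)) (Q (z, u, p)) = h (P (z, u, q)) (Q (z, u, q))" by simp
  qed
qed

lemma pd_add:
  assumes "pdiff c P" "pdiff c Q"
  shows "pdiff c (\<lambda>x. P x + Q x)" "pd c (\<lambda>x. P x + Q x) = (\<lambda>x. pd c P x + pd c Q x)"
proof -
  have D: "((\<lambda>s. P (translate c s x) + Q (translate c s x)) has_vector_derivative
          (pd c P x + pd c Q x)) (at 0)" for x
    by (intro has_vector_derivative_add pdiff_has_derivative_0 assms)
  show "pdiff c (\<lambda>x. P x + Q x)" "pd c (\<lambda>x. P x + Q x) = (\<lambda>x. pd c P x + pd c Q x)"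
    by (rule pdI[OF D])+
qed

lemma pd_mult:
  assumes "pdiff c P" "pdiff c Q"
  shows "pdiff c (\<lambda>x. P x * Q x)" "pd c (\<lambda>x. P x * Q x) = (\<lambda>x. P x * pd c Q x + pd c P x * Q x)"
proof -
  have "((\<lambda>s. P (translate c s x) * Q (translate c s x)) has_vector_derivative
          (P x * pd c Q x + pd c P x * Q x)) (at 0)" for x
    using has_vector_derivative_mult[OF pdiff_has_derivative_0[OF assms(1)] pdiff_has_derivative_0[OF assms(2)]]
    by simp
  then show "pdiff c (\<lambda>x. P x * Q x)" "pd c (\<lambda>x. P x * Q x) = (\<lambda>x. P x * pd c Q x + pd c P x * Q x)"
    by (rule pdI)+
qed

lemma pd_cnj:
  assumes "pdiff c P"
  shows "pdiff c (\<lambda>x. cnj (P x))" "pd c (\<lambda>x. cnj (P x)) = (\<lambda>x. cnj (pd c P x))"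
proof -
  have D: "((\<lambda>s. cnj (P (translate c s x))) has_vector_derivative cnj (pd c P x)) (at 0)" for x
    by (intro has_vector_derivative_cnj pdiff_has_derivative_0 assms)
  show "pdiff c (\<lambda>x. cnj (P x))" "pd c (\<lambda>x. cnj (P x)) = (\<lambda>x. cnj (pd c P x))"
    by (rule pdI[OF D])+
qed

lemma pd_const: "pdiff c (\<lambda>x. k)" "pd c (\<lambda>x. k) = (\<lambda>x. 0)"
  by (rule pdI[OF has_vector_derivative_const])+

text \<open>Derivatives of a product are sums of products, so the class invariant under
  \<open>pd\<close> must be the whole algebra generated by smooth functions.\<close>

inductive_set jet_alg :: "(jet \<Rightarrow> complex) set" where
  base: "smooth_jet P \<Longrightarrow> P \<in> jet_alg"
| add: "P \<in> jet_alg \<Longrightarrow> Q \<in> jet_alg \<Longrightarrow> (\<lambda>x. P x + Q x) \<in> jet_alg"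
| mult: "P \<in> jet_alg \<Longrightarrow> Q \<in> jet_alg \<Longrightarrow> (\<lambda>x. P x * Q x) \<in> jet_alg"

lemma jet_alg_smooth:
  assumes "P \<in> jet_alg"
  shows "smooth_jet P"
proof -
  have "finitely_many_coords Q \<and> continuous_on UNIV Q \<and> (\<forall>c. pdiff c Q) \<and> (\<forall>c. pd c Q \<in> jet_alg)"
    if "Q \<in> jet_alg" for Q
    using that
  proof induction
    case (base P)
    then show ?case using smooth_jetD smooth_jet_pd jet_alg.base by blast
  next
    case (add P Q)
    then have c: "continuous_on UNIV P" "continuous_on UNIV Q" and d: "pdiff c P" "pdiff c Q" for c
      by auto
    show ?case
    proof (intro conjI allI)
      show "finitely_many_coords (\<lambda>x. P x + Q x)"
        using add by (intro finitely_many_coords_op[where h = "(+)"]) auto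
      show "continuous_on UNIV (\<lambda>x. P x + Q x)" by (intro continuous_on_add c)
      show "pdiff c (\<lambda>x. P x + Q x)" for c by (intro pd_add d)
      show "pd c (\<lambda>x. P x + Q x) \<in> jet_alg" for c
        unfolding pd_add(2)[OF d] using add by (intro jet_alg.add) auto
    qed
  next
    case (mult P Q)
    then have c: "continuous_on UNIV P" "continuous_on UNIV Q" and d: "pdiff c P" "pdiff c Q" for c
      by auto
    show ?case
    proof (intro conjI allI)
      show "finitely_many_coords (\<lambda>x. P x * Q x)"
        using mult by (intro finitely_many_coords_op[where h = "(*)"]) auto
      show "continuous_on UNIV (\<lambda>x. P x * Q x)" by (intro continuous_on_mult c)
      show "pdiff c (\<lambda>x. P x * Q x)" for c by (intro pd_mult d)
      have "P \<in> jet_alg" "Q \<in> jet_alg" "pd c P \<in> jet_alg" "pd c Q \<in> jet_alg" for c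
        using mult by auto
      then show "pd c (\<lambda>x. P x * Q x) \<in> jet_alg" for c
        unfolding pd_mult(2)[OF d]
        by (intro jet_alg.add[OF jet_alg.mult jet_alg.mult])
    qed
  qed
  then show ?thesis
    using smooth_jetI[OF assms] by blast
qed

lemma smooth_jet_add: "smooth_jet P \<Longrightarrow> smooth_jet Q \<Longrightarrow> smooth_jet (\<lambda>x. P x + Q x)"
  and smooth_jet_mult: "smooth_jet P \<Longrightarrow> smooth_jet Q \<Longrightarrow> smooth_jet (\<lambda>x. P x * Q x)"
  by (auto intro: jet_alg_smooth jet_alg.intros)

lemma smooth_jet_const: "smooth_jet (\<lambda>x. k)"
  by (rule smooth_jetI[of _ "range (\<lambda>k x. k)"])
    (auto simp: pd_const finitely_many_coords_def)

lemma smooth_jet_cnj: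
  assumes "smooth_jet P"
  shows "smooth_jet (\<lambda>x. cnj (P x))"
proof (rule smooth_jetI[of _ "{\<lambda>x. cnj (P x) |P. smooth_jet P}"])
  fix Q c assume "Q \<in> {\<lambda>x. cnj (P x) |P. smooth_jet P}"
  then obtain P where Q: "Q = (\<lambda>x. cnj (P x))" and P: "smooth_jet P" by auto
  show "finitely_many_coords Q"
    unfolding Q using finitely_many_coords_op[OF smooth_jetD(1)[OF P] smooth_jetD(1)[OF P], of "\<lambda>x y. cnj x"] .
  show "continuous_on UNIV Q" unfolding Q by (intro continuous_on_cnj smooth_jetD P)
  show "pdiff c Q" unfolding Q by (intro pd_cnj smooth_jetD P)
  have "pd c Q = (\<lambda>x. cnj (pd c P x))" unfolding Q by (intro pd_cnj smooth_jetD P)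
  then show "pd c Q \<in> {\<lambda>x. cnj (P x) |P. smooth_jet P}" using smooth_jet_pd[OF P] by blast
qed (use assms in blast)

lemma pd_coord:
  "pdiff c (\<lambda>(z, u, p). p i)"
  "pd c (\<lambda>(z, u, p). p i) = (\<lambda>x. if c = Re_u i then 1 else if c = Im_u i then \<i> else 0)"
proof -
  have 1: "((\<lambda>s. p + complex_of_real s) has_vector_derivative 1) (at 0)" for p
    unfolding has_vector_derivative_def
    by (auto intro!: derivative_eq_intros simp: scaleR_conv_of_real)
  have 2: "((\<lambda>s. p + \<i> * complex_of_real s) has_vector_derivative \<i>) (at 0)" for p
    unfolding has_vector_derivative_def
    by (auto intro!: derivative_eq_intros simp: scaleR_conv_of_real)
  have "((\<lambda>s. (\<lambda>(z, u, p). p i) (translate c s x)) has_vector_derivative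
     (if c = Re_u i then 1 else if c = Im_u i then \<i> else 0)) (at 0)" for x
    by (cases c; cases x) (auto simp: 1 2)
  then show "pdiff c (\<lambda>(z, u, p). p i)"
    "pd c (\<lambda>(z, u, p). p i) = (\<lambda>x. if c = Re_u i then 1 else if c = Im_u i then \<i> else 0)"
    by (rule pdI)+
qed

lemma smooth_jet_coord: "smooth_jet (\<lambda>(z, u, p). p i)"
proof (rule smooth_jetI[of _ "insert (\<lambda>(z, u, p). p i) (range (\<lambda>k x. k))"])
  fix Q c assume Q: "Q \<in> insert (\<lambda>(z :: complex, u :: real, p). p i :: complex) (range (\<lambda>k x. k))"
  show "finitely_many_coords Q" using Q by (auto simp: finitely_many_coords_def)
  have "continuous_on UNIV (\<lambda>x :: jet. snd (snd x))" by (intro continuous_intros)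
  then have "continuous_on UNIV (\<lambda>x :: jet. snd (snd x) i)"
    by (rule continuous_on_product_then_coordinatewise)
  then show "continuous_on UNIV Q" using Q by (auto simp: split_beta)
  show "pdiff c Q" using Q pd_coord(1) pd_const(1) by auto
  show "pd c Q \<in> insert (\<lambda>(z, u, p). p i) (range (\<lambda>k x. k))"
    using Q by (auto simp: pd_coord(2) pd_const(2))
qed blast

lemma pd_of_u:
  fixes g :: "real \<Rightarrow> complex"
  assumes "\<And>u. (g has_vector_derivative g' u) (at u)"
  shows "pdiff c (\<lambda>(z, u, p). g u)"
    "pd c (\<lambda>(z, u, p). g u) = (\<lambda>(z, u, p). if c = U then g' u else 0)"
proof -
  have 1: "((\<lambda>s. g (u + s)) has_vector_derivative g' u) (at 0)" for u
  proof -
    have B: "((\<lambda>s. u + s) has_vector_derivative 1) (at 0)"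
      by (auto intro!: derivative_eq_intros)
    have "((g \<circ> (\<lambda>s. u + s)) has_vector_derivative (1 *\<^sub>R g' u)) (at 0)"
      by (rule vector_diff_chain_at[OF B]) (use assms in simp)
    then show ?thesis by (simp add: o_def)
  qed
  have "((\<lambda>s. (\<lambda>(z, u, p). g u) (translate c s x)) has_vector_derivative
     (\<lambda>(z, u, p). if c = U then g' u else 0) x) (at 0)" for x
    by (cases c; cases x) (auto simp: 1)
  then show "pdiff c (\<lambda>(z, u, p). g u)"
    "pd c (\<lambda>(z, u, p). g u) = (\<lambda>(z, u, p). if c = U then g' u else 0)"
    by (rule pdI)+
qed

lemma has_vector_derivative_of_real_comp:
  assumes "(f has_real_derivative f') (at u)"
  shows "((\<lambda>u. complex_of_real (f u)) has_vector_derivative of_real f') (at u)"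
  using assms has_vector_derivative_of_real
  by (metis has_real_derivative_iff_has_vector_derivative)

text \<open>As f'' = \<beta> f, the span of f and f' is closed under d/du and serves as the
  invariant class.\<close>

lemma smooth_jet_of_u:
  fixes f f' :: "real \<Rightarrow> real"
  assumes f: "\<And>u. (f has_real_derivative f' u) (at u)"
    and f': "\<And>u. (f' has_real_derivative \<beta> * f u) (at u)"
  shows "smooth_jet (\<lambda>(z, u, p). of_real (a * f u + b * f' u))"
proof -
  let ?S = "{\<lambda>(z :: complex, u, p :: nat \<Rightarrow> complex). complex_of_real (a * f u + b * f' u) |a b. True}"
  show ?thesis
  proof (rule smooth_jetI[of _ "?S"])
  have d: "((\<lambda>u. complex_of_real (a * f u + b * f' u)) has_vector_derivative
         of_real (b * \<beta> * f u + a * f' u)) (at u)" for a b u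
    by (rule has_vector_derivative_of_real_comp)
       (auto intro!: derivative_eq_intros f f')
  have c: "continuous_on UNIV f" "continuous_on UNIV f'"
    using f f' by (meson DERIV_isCont continuous_at_imp_continuous_on)+
  have c': "continuous_on UNIV (\<lambda>x. f (fst (snd x)))" "continuous_on UNIV (\<lambda>x. f' (fst (snd x)))"
    by (auto intro!: continuous_on_compose2[OF c(1)] continuous_on_compose2[OF c(2)] continuous_intros)
  fix Q :: "jet \<Rightarrow> complex" and c
  assume "Q \<in> ?S"
  then obtain a b where Q: "Q = (\<lambda>(z, u, p). of_real (a * f u + b * f' u))" by blast
  show "finitely_many_coords Q" by (auto simp: Q finitely_many_coords_def)
  show "continuous_on UNIV Q" unfolding Q split_beta
    by (intro continuous_intros c')
  show "pdiff c Q" unfolding Q by (rule pd_of_u[OF d])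
  have "pd c Q = (\<lambda>(z, u, p). if c = U then of_real (b * \<beta> * f u + a * f' u) else 0)"
    unfolding Q by (rule pd_of_u[OF d])
  also have "\<dots> = (\<lambda>(z, u, p). of_real ((if c = U then b * \<beta> else 0) * f u + (if c = U then a else 0) * f' u))"
    by auto
  finally have E: "pd c Q = \<dots>" .
  show "pd c Q \<in> ?S"
    unfolding E mem_Collect_eq
    by (rule exI[of _ "if c = U then b * \<beta> else 0"], rule exI[of _ "if c = U then a else 0"]) simp
next
  show "(\<lambda>(z :: complex, u, p :: nat \<Rightarrow> complex). complex_of_real (a * f u + b * f' u)) \<in> ?S"
    unfolding mem_Collect_eq by (rule exI[of _ a], rule exI[of _ b]) simp
qed
qed

text \<open>Schwarz's theorem from continuity of the iterated partial derivatives: write the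
  increment of P in the direction c' as an integral of \<open>pd c' P\<close>, differentiate under
  the integral sign in the direction c, then differentiate in the upper limit.\<close>

lemma pd_commute:
  assumes P: "smooth_jet P"
  shows "pd c (pd c' P) = pd c' (pd c P)"
proof
  fix x :: jet
  define g where "g s t = translate c s (translate c' t x)" for s t
  have g': "g s t = translate c' t (translate c s x)" for s t
    unfolding g_def by (rule translate_commute)
  define A where "A = pd c P"
  define B where "B = pd c' P"
  have sA: "smooth_jet A" and sB: "smooth_jet B"
    unfolding A_def B_def by (intro smooth_jet_pd P)+
  define C where "C = pd c B"
  have sC: "smooth_jet C" unfolding C_def by (intro smooth_jet_pd sB)
  have cont_g: "continuous_on UNIV (\<lambda>(s, t). g s t)"
    unfolding g_def split_beta
    by (intro continuous_on_translate continuous_intros)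
  have cont: "continuous_on S (\<lambda>(s, t). Q (g s t))" if "smooth_jet Q" for Q S
    using continuous_on_compose2[OF smooth_jetD(2)[OF that] cont_g]
    by (auto simp: split_beta intro: continuous_on_subset)
  have cont_t: "continuous_on S (\<lambda>t. Q (g s t))" if "smooth_jet Q" for Q S s
  proof -
    have "continuous_on S (\<lambda>t. g s t)" unfolding g_def
      by (intro continuous_on_translate continuous_intros)
    then show ?thesis
      using continuous_on_compose2[OF smooth_jetD(2)[OF that]] by auto
  qed
  have key: "A (g 0 t) - A (g 0 0) = integral {0..t} (\<lambda>\<tau>. C (g 0 \<tau>))" if t: "t \<in> {0..1}" for t
  proof -
    have FTC: "((\<lambda>\<tau>. B (g s \<tau>)) has_integral (P (g s t) - P (g s 0))) {0..t}" for s
    proof (rule fundamental_theorem_of_calculus)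
      show "((\<lambda>\<tau>. P (g s \<tau>)) has_vector_derivative B (g s \<tau>)) (at \<tau> within {0..t})" for \<tau>
        unfolding g' B_def
        by (rule has_vector_derivative_at_within[OF pdiff_has_derivative[OF smooth_jetD(3)[OF P]]])
    qed (use t in auto)
    have "((\<lambda>s. integral (cbox 0 t) (\<lambda>\<tau>. B (g s \<tau>))) has_vector_derivative
             integral (cbox 0 t) (\<lambda>\<tau>. C (g 0 \<tau>))) (at 0 within UNIV)"
    proof (rule leibniz_rule_vector_derivative)
      show "((\<lambda>s. B (g s \<tau>)) has_vector_derivative C (g s \<tau>)) (at s within UNIV)" for s \<tau>
        unfolding g_def C_def
        by (rule has_vector_derivative_at_within[OF pdiff_has_derivative[OF smooth_jetD(3)[OF sB]]])
      show "(\<lambda>\<tau>. B (g s \<tau>)) integrable_on cbox 0 t" for s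
        using FTC by auto
      show "continuous_on (UNIV \<times> cbox 0 t) (\<lambda>(s, \<tau>). C (g s \<tau>))"
        by (rule cont[OF sC])
    qed auto
    moreover have "integral (cbox 0 t) (\<lambda>\<tau>. B (g s \<tau>)) = P (g s t) - P (g s 0)" for s
      using FTC[of s] by (simp add: integral_unique)
    ultimately have "((\<lambda>s. P (g s t) - P (g s 0)) has_vector_derivative
             integral {0..t} (\<lambda>\<tau>. C (g 0 \<tau>))) (at 0)" by simp
    moreover have "((\<lambda>s. P (g s t) - P (g s 0)) has_vector_derivative (A (g 0 t) - A (g 0 0))) (at 0)"
      unfolding g_def A_def
      by (rule has_vector_derivative_diff[OF pdiff_has_derivative[OF smooth_jetD(3)[OF P]] pdiff_has_derivative[OF smooth_jetD(3)[OF P]]])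
    ultimately show ?thesis
      by (rule vector_derivative_unique_at[THEN sym])
  qed
  have "((\<lambda>t. integral {0..t} (\<lambda>\<tau>. C (g 0 \<tau>))) has_vector_derivative C (g 0 0)) (at 0 within {0..1})"
    by (rule integral_has_vector_derivative) (use cont_t[OF sC] in auto)
  then have "((\<lambda>t. A (g 0 t) - A (g 0 0)) has_vector_derivative C (g 0 0)) (at 0 within {0..1})"
    by (rule has_vector_derivative_transform[rotated 2]) (auto simp: key)
  moreover have "((\<lambda>t. A (g 0 t) - A (g 0 0)) has_vector_derivative (pd c' A (g 0 0) - 0)) (at 0 within {0..1})"
    unfolding g' 
    by (rule has_vector_derivative_diff[OF has_vector_derivative_at_within[OF pdiff_has_derivative[OF smooth_jetD(3)[OF sA]]]
          has_vector_derivative_const])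
  ultimately have "C (g 0 0) = pd c' A (g 0 0) - 0"
    by (rule vector_derivative_unique_within[rotated]) (simp add: at_within_Icc_at_right)
  then show "pd c (pd c' P) x = pd c' (pd c P) x"
    by (simp add: g_def A_def B_def C_def)
qed

text \<open>Continuity of a partial derivative upgrades the two partial derivatives to a total real
  derivative in u_k. It is used for chain rules with complex scalings and for the Cauchy-Riemann
  equations.\<close>

lemma has_derivative_coord:
  assumes P: "smooth_jet P"
  shows "((\<lambda>\<zeta>. P (z, u, p(k := \<zeta>))) has_derivative
    (\<lambda>h. of_real (Re h) * pd (Re_u k) P (z, u, p(k := \<zeta>)) + of_real (Im h) * pd (Im_u k) P (z, u, p(k := \<zeta>)))) (at \<zeta>)"
proof -
  define g where "g a b = translate (Re_u k) a (translate (Im_u k) b (z, u, p(k := 0)))" for a b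
  have g': "g a b = translate (Im_u k) b (translate (Re_u k) a (z, u, p(k := 0)))" for a b
    unfolding g_def by (rule translate_commute)
  have g_eq: "g (Re w) (Im w) = (z, u, p(k := w))" for w
    by (simp add: g_def complex_eq_iff fun_eq_iff)
  define Px where "Px = pd (Re_u k) P"
  define Py where "Py = pd (Im_u k) P"
  have sPy: "smooth_jet Py" unfolding Py_def by (intro smooth_jet_pd P)
  have "continuous_on UNIV (\<lambda>(a, b). g a b)"
    unfolding g_def split_beta
    by (intro continuous_on_translate continuous_intros)
  then have "continuous_on UNIV (\<lambda>(a, b). Py (g a b))"
    using continuous_on_compose2[OF smooth_jetD(2)[OF sPy]] by (auto simp: split_beta)
  then have cont: "continuous_on UNIV (\<lambda>(a, b). blinfun_scaleR_left (Py (g a b)))"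
    by (auto simp: split_beta intro!: continuous_intros)
  have "((\<lambda>(a, b). P (g a b)) has_derivative
      (\<lambda>(tx, ty). tx *\<^sub>R Px (g (Re \<zeta>) (Im \<zeta>)) + blinfun_scaleR_left (Py (g (Re \<zeta>) (Im \<zeta>))) ty)) (at (Re \<zeta>, Im \<zeta>) within UNIV \<times> UNIV)"
  proof (rule has_derivative_partialsI)
    have "((\<lambda>a. P (g a (Im \<zeta>))) has_vector_derivative Px (g (Re \<zeta>) (Im \<zeta>))) (at (Re \<zeta>))"
      unfolding g_def Px_def by (rule pdiff_has_derivative[OF smooth_jetD(3)[OF P]])
    then show "((\<lambda>a. P (g a (Im \<zeta>))) has_derivative (\<lambda>tx. tx *\<^sub>R Px (g (Re \<zeta>) (Im \<zeta>)))) (at (Re \<zeta>))"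
      by (simp add: has_vector_derivative_def)
    fix a b :: real
    have "((\<lambda>b. P (g a b)) has_vector_derivative Py (g a b)) (at b)"
      unfolding g' Py_def by (rule pdiff_has_derivative[OF smooth_jetD(3)[OF P]])
    then show "((\<lambda>b. P (g a b)) has_derivative blinfun_scaleR_left (Py (g a b))) (at b within UNIV)"
      by (simp add: has_vector_derivative_def)
  next
    show "continuous (at (Re \<zeta>, Im \<zeta>) within UNIV \<times> UNIV) (\<lambda>(a, b). blinfun_scaleR_left (Py (g a b)))"
      using cont by (simp add: continuous_on_eq_continuous_within)
  qed auto
  then have d: "((\<lambda>(a, b). P (g a b)) has_derivative
      (\<lambda>(tx, ty). tx *\<^sub>R Px (g (Re \<zeta>) (Im \<zeta>)) + ty *\<^sub>R Py (g (Re \<zeta>) (Im \<zeta>)))) (at (Re \<zeta>, Im \<zeta>))"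
    by simp
  have "((\<lambda>w. (Re w, Im w)) has_derivative (\<lambda>w. (Re w, Im w))) (at \<zeta>)"
    by (intro has_derivative_Pair bounded_linear_imp_has_derivative bounded_linear_Re bounded_linear_Im)
  from has_derivative_compose[OF this d]
  show ?thesis
    by (simp add: g_eq Px_def Py_def scaleR_conv_of_real)
qed

section \<open>The ring of smooth functions and its derivations\<close>

text \<open>With smoothness hidden in a type, functions form a commutative ring on which all
  differential operators are total, so later computations carry no smoothness side
  conditions.\<close>

typedef sjet = "{P. smooth_jet P}"
  morphisms val Sjet
  using smooth_jet_const by blast

setup_lifting type_definition_sjet

instantiation sjet :: comm_ring_1
begin
lift_definition zero_sjet :: sjet is "\<lambda>x. 0" by (rule smooth_jet_const)
lift_definition one_sjet :: sjet is "\<lambda>x. 1" by (rule smooth_jet_const)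
lift_definition plus_sjet :: "sjet \<Rightarrow> sjet \<Rightarrow> sjet" is "\<lambda>P Q x. P x + Q x"
  by (rule smooth_jet_add)
lift_definition times_sjet :: "sjet \<Rightarrow> sjet \<Rightarrow> sjet" is "\<lambda>P Q x. P x * Q x"
  by (rule smooth_jet_mult)
lift_definition uminus_sjet :: "sjet \<Rightarrow> sjet" is "\<lambda>P x. - 1 * P x"
  by (intro smooth_jet_mult smooth_jet_const)
lift_definition minus_sjet :: "sjet \<Rightarrow> sjet \<Rightarrow> sjet" is "\<lambda>P Q x. P x + - 1 * Q x"
  by (intro smooth_jet_add smooth_jet_mult smooth_jet_const)
instance
  by standard (transfer; simp add: fun_eq_iff algebra_simps)+
end

lift_definition cst :: "complex \<Rightarrow> sjet" is "\<lambda>k x. k" by (rule smooth_jet_const)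
lift_definition cj :: "sjet \<Rightarrow> sjet" is "\<lambda>P x. cnj (P x)" by (rule smooth_jet_cnj)
lift_definition coord :: "nat \<Rightarrow> sjet" is "\<lambda>i (z, u, p). p i" by (rule smooth_jet_coord)
lift_definition dc :: "real_coord \<Rightarrow> sjet \<Rightarrow> sjet" is pd by (rule smooth_jet_pd)

lemma sjet_eqI: "(\<And>z u p. val x (z, u, p) = val y (z, u, p)) \<Longrightarrow> x = y"
  by transfer (auto simp: fun_eq_iff)

lemma val_simps [simp]:
  "val 0 x = 0" "val 1 x = 1" "val (a + b) x = val a x + val b x" "val (a - b) x = val a x - val b x"
  "val (- a) x = - val a x" "val (a * b) x = val a x * val b x" "val (cst k) x = k"
  "val (cj a) x = cnj (val a x)" "val (coord i) (z, u, p) = p i"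
  by (transfer; simp)+

lemma val_sum [simp]: "val (\<Sum>i\<in>S. g i) x = (\<Sum>i\<in>S. val (g i) x)"
  by (induction S rule: infinite_finite_induct) auto

lemma val_of_nat [simp]: "val (of_nat n) x = of_nat n"
  by (induction n) auto

lemma val_numeral [simp]: "val (numeral n) x = numeral n"
  using val_of_nat[of "numeral n" x] by simp

lemma smooth_val [simp]: "smooth_jet (val a)"
  using val by blast

lemma val_dc: "val (dc c a) = pd c (val a)"
  by transfer simp

lemma cj_simps [simp]: "cj 0 = 0" "cj 1 = 1" "cj (a + b) = cj a + cj b" "cj (a - b) = cj a - cj b"
  "cj (- a) = - cj a" "cj (a * b) = cj a * cj b" "cj (cst k) = cst (cnj k)" "cj (cj a) = a"
  by (rule sjet_eqI; simp)+

lemma cj_sum: "cj (\<Sum>i\<in>S. g i) = (\<Sum>i\<in>S. cj (g i))"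
  by (rule sjet_eqI) simp

lemma cj_eq_0 [simp]: "cj a = 0 \<longleftrightarrow> a = 0"
  by (metis cj_simps(1,8))

lemma cst_simps: "cst 0 = 0" "cst 1 = 1" "cst (a + b) = cst a + cst b" "cst (a - b) = cst a - cst b"
  "cst (- a) = - cst a" "cst (a * b) = cst a * cst b"
  by (rule sjet_eqI; simp)+

lemma cst_2: "cst 2 = 2"
  using cst_simps(3)[of 1 1] by (simp add: cst_simps)

lemma cst_cancel: "k \<noteq> 0 \<Longrightarrow> cst k * a = 0 \<longleftrightarrow> a = 0"
  by (metis cst_simps(2,6) left_inverse mult.assoc mult_1 mult_zero_right)

locale derivation =
  fixes \<delta> :: "sjet \<Rightarrow> sjet"
  assumes add: "\<delta> (a + b) = \<delta> a + \<delta> b"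
    and mult: "\<delta> (a * b) = \<delta> a * b + a * \<delta> b"
    and cst: "\<delta> (cst k) = 0"
begin

lemma zero: "\<delta> 0 = 0" and one: "\<delta> 1 = 0"
  using cst[of 0] cst[of 1] by (simp_all add: cst_simps)

lemma cst_mult: "\<delta> (cst k * a) = cst k * \<delta> a"
  by (simp add: mult cst)

lemma minus: "\<delta> (- a) = - \<delta> a"
  using add[of a "- a"] by (simp add: zero eq_neg_iff_add_eq_0 add.commute)

lemma diff: "\<delta> (a - b) = \<delta> a - \<delta> b"
  using add[of a "- b"] by (simp add: minus)

lemma sum: "\<delta> (\<Sum>i\<in>S. g i) = (\<Sum>i\<in>S. \<delta> (g i))"
  by (induction S rule: infinite_finite_induct) (auto simp: zero add)

lemmas simps = add mult cst zero one minus diff sum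

end

lemma derivation_dc: "derivation (dc c)"
proof
  fix a b :: sjet and k
  have d: "pdiff c (val a)" "pdiff c (val b)" by (simp_all add: smooth_jetD)
  have v: "val (a + b) = (\<lambda>x. val a x + val b x)" "val (a * b) = (\<lambda>x. val a x * val b x)"
    "val (cst k) = (\<lambda>x. k)"
    by (auto simp: fun_eq_iff)
  show "dc c (a + b) = dc c a + dc c b"
    by (rule sjet_eqI) (simp add: val_dc v pd_add(2)[OF d])
  show "dc c (a * b) = dc c a * b + a * dc c b"
    by (rule sjet_eqI) (simp add: val_dc v pd_mult(2)[OF d])
  show "dc c (cst k) = 0"
    by (rule sjet_eqI) (simp add: val_dc v pd_const)
qed

interpretation dc: derivation "dc c" for c by (rule derivation_dc)

lemma dc_commute: "dc c (dc c' a) = dc c' (dc c a)"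
  by transfer (rule pd_commute)

lemma cj_dc: "cj (dc c a) = dc c (cj a)"
proof (rule sjet_eqI)
  fix z u p
  have "val (cj a) = (\<lambda>x. cnj (val a x))" by (auto simp: fun_eq_iff)
  then show "val (cj (dc c a)) (z, u, p) = val (dc c (cj a)) (z, u, p)"
    by (simp add: val_dc pd_cnj smooth_jetD)
qed

lemma dc_coord: "dc c (coord i) = cst (if c = Re_u i then 1 else if c = Im_u i then \<i> else 0)"
proof (rule sjet_eqI)
  fix z u p
  have "val (coord i) = (\<lambda>(z, u, p). p i)" by (simp add: coord.rep_eq)
  then show "val (dc c (coord i)) (z, u, p) =
      val (cst (if c = Re_u i then 1 else if c = Im_u i then \<i> else 0)) (z, u, p)"
    by (simp add: val_dc pd_coord)
qed

text \<open>The Wirtinger derivatives are the cases \<open>k = - \<i>\<close> and \<open>k = \<i>\<close>.\<close>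

definition wd :: "complex \<Rightarrow> real_coord \<Rightarrow> real_coord \<Rightarrow> sjet \<Rightarrow> sjet" where
  "wd k c c' a = cst (1 / 2) * (dc c a + cst k * dc c' a)"

lemma derivation_wd: "derivation (wd k c c')"
  by standard (auto simp: wd_def dc.simps algebra_simps)

lemma wd_dc_commute: "wd k c c' (dc e a) = dc e (wd k c c' a)"
  by (simp add: wd_def dc.simps dc_commute[of _ e])

lemma wd_commute: "wd k c c' (wd l e e' a) = wd l e e' (wd k c c' a)"
  by (simp add: wd_def dc.simps dc_commute[of e] dc_commute[of e'] algebra_simps)

lemma cj_wd: "cj (wd k c c' a) = wd (cnj k) c c' (cj a)"
  by (simp add: wd_def cj_dc)

abbreviation dz :: "sjet \<Rightarrow> sjet" where "dz \<equiv> wd (- \<i>) Re_z Im_z"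
abbreviation dzb :: "sjet \<Rightarrow> sjet" where "dzb \<equiv> wd \<i> Re_z Im_z"
abbreviation dU :: "sjet \<Rightarrow> sjet" where "dU \<equiv> dc U"
abbreviation du :: "nat \<Rightarrow> sjet \<Rightarrow> sjet" where "du i \<equiv> wd (- \<i>) (Re_u i) (Im_u i)"
abbreviation dub :: "nat \<Rightarrow> sjet \<Rightarrow> sjet" where "dub i \<equiv> wd \<i> (Re_u i) (Im_u i)"

interpretation wd: derivation "wd k c c'" for k c c' by (rule derivation_wd)

lemma val_wirtinger:
  "val (dz a) x = pd_z (val a) x" "val (du i a) x = pd_u i (val a) x" "val (dub i a) x = pd_ubar i (val a) x"
  by (simp_all add: wd_def val_dc pd_z_def pd_u_def pd_ubar_def)

lemma wd_coord: "du i (coord j) = (if i = j then 1 else 0)" "dub i (coord j) = 0"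
  "dz (coord j) = 0" "dzb (coord j) = 0" "dU (coord j) = 0"
  by (rule sjet_eqI; simp add: wd_def dc_coord)+

lemma dc_eq_0:
  assumes "du i a = 0" "dub i a = 0"
  shows "dc (Re_u i) a = 0" "dc (Im_u i) a = 0"
proof -
  have "dc (Re_u i) a = du i a + dub i a" "cst \<i> * dc (Im_u i) a = dub i a - du i a"
    by (rule sjet_eqI; simp add: wd_def field_simps)+
  then show "dc (Re_u i) a = 0" "dc (Im_u i) a = 0"
    using assms by (simp_all add: cst_cancel)
qed

section \<open>Vector fields in the jet variables\<close>

lemma finite_support_wd: "finite {i. wd k (Re_u i) (Im_u i) a \<noteq> 0}"
proof -
  obtain n where n: "\<And>z u p q. (\<forall>i<n. p i = q i) \<Longrightarrow> val a (z, u, p) = val a (z, u, q)"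
    using smooth_jetD(1)[OF smooth_val[of a]] unfolding finitely_many_coords_def by metis
  have "dc c a = 0" if "c = Re_u i \<or> c = Im_u i" "i \<ge> n" for i c
  proof (rule sjet_eqI)
    fix z u p
    have "(\<lambda>t. val a (translate c t (z, u, p))) = (\<lambda>t. val a (z, u, p))"
      using that by (auto intro!: n ext)
    then show "val (dc c a) (z, u, p) = val 0 (z, u, p)"
      by (simp add: val_dc pd_def)
  qed
  then have "wd k (Re_u i) (Im_u i) a = 0" if "i \<ge> n" for i
    using that by (simp add: wd_def)
  then have "{i. wd k (Re_u i) (Im_u i) a \<noteq> 0} \<subseteq> {..<n}"
    by (auto intro!: not_le_imp_less)
  then show ?thesis by (rule finite_subset) simp
qed

text \<open>The formally infinite field is cut down to the finite support of its argument;
  \<open>vf_eq\<close> permits any larger finite index set, so that several functions can share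
  one.\<close>

definition vf :: "(nat \<Rightarrow> sjet) \<Rightarrow> sjet \<Rightarrow> sjet" where
  "vf c a = (\<Sum>i | du i a \<noteq> 0. c i * du i a)"

lemma vf_eq:
  assumes "finite S" "\<And>i. i \<notin> S \<Longrightarrow> du i a = 0"
  shows "vf c a = (\<Sum>i\<in>S. c i * du i a)"
  unfolding vf_def using assms by (intro sum.mono_neutral_left) auto

lemma derivation_vf: "derivation (vf c)"
proof
  fix a b :: sjet and k
  let ?S = "{i. du i a \<noteq> 0} \<union> {i. du i b \<noteq> 0}"
  have S: "finite ?S" by (simp add: finite_support_wd)
  have e: "vf c a = (\<Sum>i\<in>?S. c i * du i a)" "vf c b = (\<Sum>i\<in>?S. c i * du i b)"
    "vf c (a + b) = (\<Sum>i\<in>?S. c i * du i (a + b))" "vf c (a * b) = (\<Sum>i\<in>?S. c i * du i (a * b))"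
    by (rule vf_eq[OF S]; simp add: wd.simps)+
  show "vf c (a + b) = vf c a + vf c b" "vf c (a * b) = vf c a * b + a * vf c b"
    unfolding e by (simp_all add: wd.simps algebra_simps sum.distrib sum_distrib_left)
  show "vf c (cst k) = 0" by (simp add: vf_def wd.cst)
qed

interpretation vf: derivation "vf c" for c by (rule derivation_vf)

lemma vf_coord [simp]: "vf c (coord i) = c i"
  by (subst vf_eq[of "{i}"]) (auto simp: wd_coord)

lemma vf_lin: "vf (\<lambda>i. a * c i + b * d i) x = a * vf c x + b * vf d x"
  by (simp add: vf_def algebra_simps sum.distrib sum_distrib_left)

lemma vf_comm_derivation:
  assumes "derivation \<delta>" and comm: "\<And>i x. \<delta> (du i x) = du i (\<delta> x)"
  shows "\<delta> (vf c x) = vf (\<lambda>i. \<delta> (c i)) x + vf c (\<delta> x)"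
proof -
  interpret derivation \<delta> by fact
  have "vf c (\<delta> x) = (\<Sum>i | du i x \<noteq> 0. c i * du i (\<delta> x))"
    by (rule vf_eq) (auto simp: finite_support_wd zero simp flip: comm)
  then show ?thesis
    by (simp add: vf_def simps comm sum.distrib)
qed

text \<open>Second-order terms cancel by symmetry of mixed derivatives, so the commutator is again a
  field, with coefficients obtained by applying each field to those of the other.\<close>

lemma vf_commutator:
  "vf c (vf d x) = vf d (vf c x) + vf (\<lambda>i. vf c (d i)) x - vf (\<lambda>i. vf d (c i)) x"
proof -
  let ?S = "{i. du i x \<noteq> 0}"
  have e: "vf c (du j x) = (\<Sum>i\<in>?S. c i * du i (du j x))" for c j
    by (rule vf_eq) (auto simp: finite_support_wd wd_commute[of _ _ _ _ "Re_u j"] wd.zero)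
  have "vf c (vf d x) = (\<Sum>j\<in>?S. vf c (d j) * du j x) + (\<Sum>j\<in>?S. \<Sum>i\<in>?S. d j * c i * du i (du j x))" for c d
    unfolding vf_def[of d x] by (simp add: vf.simps e sum.distrib sum_distrib_left algebra_simps)
  note E = this
  have "(\<Sum>j\<in>?S. \<Sum>i\<in>?S. d j * c i * du i (du j x)) = (\<Sum>j\<in>?S. \<Sum>i\<in>?S. c j * d i * du i (du j x))"
    by (subst sum.swap, intro sum.cong refl) (subst wd_commute, simp add: mult.commute)
  then show ?thesis
    unfolding E[of c d] E[of d c] by (simp add: vf_def[of _ x])
qed

section \<open>Splitting the equation\<close>

text \<open>Since \<open>f\<close> satisfies \<open>f\<^sub>u\<^sub>u = \<beta> f\<close>, one has \<open>T\<^sup>i = f a\<^sub>i + f\<^sub>u b\<^sub>i\<close> with polynomials \<open>a\<^sub>i = Ta \<beta> i\<close> and \<open>b\<^sub>i = Tb \<beta> i\<close>.\<close>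

fun Ta :: "complex \<Rightarrow> nat \<Rightarrow> sjet" and Tb :: "complex \<Rightarrow> nat \<Rightarrow> sjet" where
  "Ta \<beta> 0 = 1"
| "Ta \<beta> (Suc i) = cst \<beta> * (\<Sum>j\<in>{..i}. of_nat (i choose j) * (coord (i - j) * Tb \<beta> j))"
| "Tb \<beta> 0 = 0"
| "Tb \<beta> (Suc i) = (\<Sum>j\<in>{..i}. of_nat (i choose j) * (coord (i - j) * Ta \<beta> j))"

abbreviation D :: "sjet \<Rightarrow> sjet" where "D \<equiv> vf (\<lambda>i. coord (Suc i))"

lemma of_nat_cst: "of_nat n = cst (of_nat n)"
  by (rule sjet_eqI) simp

lemma (in derivation) of_nat: "\<delta> (of_nat n) = 0"
  unfolding of_nat_cst by (rule cst)

text \<open>Pascal's rule in the form of one more differentiation of a Leibniz expansion.\<close>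

lemma sum_binomial_Suc:
  fixes g X :: "nat \<Rightarrow> 'a::comm_semiring_1"
  shows "(\<Sum>j\<le>Suc i. of_nat (Suc i choose j) * (g (Suc i - j) * X j)) =
    (\<Sum>j\<le>i. of_nat (i choose j) * (g (Suc (i - j)) * X j + g (i - j) * X (Suc j)))"
proof -
  have 1: "(\<Sum>j\<le>i. of_nat (i choose j) * (g (Suc (i - j)) * X j)) =
      (\<Sum>j\<le>Suc i. of_nat (i choose j) * (g (Suc i - j) * X j))"
    by (simp add: Suc_diff_le binomial_eq_0)
  have 2: "(\<Sum>j\<le>Suc i. of_nat (i choose j) * (g (Suc i - j) * X j)) =
     g (Suc i) * X 0 + (\<Sum>j\<le>i. of_nat (i choose Suc j) * (g (i - j) * X (Suc j)))"
    by (subst sum.atMost_Suc_shift) simp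
  have "(\<Sum>j\<le>Suc i. of_nat (Suc i choose j) * (g (Suc i - j) * X j)) =
     (g (Suc i) * X 0 + (\<Sum>j\<le>i. of_nat (i choose Suc j) * (g (i - j) * X (Suc j))))
     + (\<Sum>j\<le>i. of_nat (i choose j) * (g (i - j) * X (Suc j)))"
    by (subst sum.atMost_Suc_shift) (simp add: distrib_right sum.distrib add_ac)
  then show ?thesis
    unfolding 2[symmetric] 1[symmetric] by (simp only: distrib_left sum.distrib)
qed

text \<open>The defining sum of T^{i+1} is the Leibniz expansion of the i-th total derivative of u_0
  f_u, the first total derivative of f. Hence T^{i+1} is the total derivative D + u_0 d/du of T^i;
  compare the coefficients of f and f_u.\<close>

lemma Tab_Suc:
  "Ta \<beta> (Suc i) = D (Ta \<beta> i) + cst \<beta> * coord 0 * Tb \<beta> i \<and> Tb \<beta> (Suc i) = D (Tb \<beta> i) + coord 0 * Ta \<beta> i"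
proof (induction i rule: less_induct)
  case (less i)
  show ?case
  proof (cases i)
    case 0
    then show ?thesis by (simp add: vf.simps)
  next
    case (Suc k)
    have IH: "Ta \<beta> (Suc j) = D (Ta \<beta> j) + cst \<beta> * coord 0 * Tb \<beta> j" "Tb \<beta> (Suc j) = D (Tb \<beta> j) + coord 0 * Ta \<beta> j"
      if "j \<le> k" for j
      using less[of j] that Suc by auto
    have "(\<Sum>j\<le>Suc k. of_nat (Suc k choose j) * (coord (Suc k - j) * Tb \<beta> j)) =
        (\<Sum>j\<le>k. of_nat (k choose j) * (coord (Suc (k - j)) * Tb \<beta> j + coord (k - j) * (D (Tb \<beta> j) + coord 0 * Ta \<beta> j)))"
      unfolding sum_binomial_Suc by (intro sum.cong refl) (simp add: IH del: Ta.simps Tb.simps)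
    also have "\<dots> = D (\<Sum>j\<le>k. of_nat (k choose j) * (coord (k - j) * Tb \<beta> j)) + coord 0 * Tb \<beta> (Suc k)"
      by (simp add: vf.simps vf.of_nat sum.distrib sum_distrib_left algebra_simps)
    finally have b: "Ta \<beta> (Suc i) = D (Ta \<beta> i) + cst \<beta> * coord 0 * Tb \<beta> i"
      unfolding Suc by (simp add: vf.simps algebra_simps del: sum.atMost_Suc)
    have "(\<Sum>j\<le>Suc k. of_nat (Suc k choose j) * (coord (Suc k - j) * Ta \<beta> j)) =
        (\<Sum>j\<le>k. of_nat (k choose j) * (coord (Suc (k - j)) * Ta \<beta> j + coord (k - j) * (D (Ta \<beta> j) + cst \<beta> * coord 0 * Tb \<beta> j)))"
      unfolding sum_binomial_Suc by (intro sum.cong refl) (simp add: IH del: Ta.simps Tb.simps)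
    also have "\<dots> = D (\<Sum>j\<le>k. of_nat (k choose j) * (coord (k - j) * Ta \<beta> j)) + coord 0 * Ta \<beta> (Suc k)"
      by (simp add: vf.simps vf.of_nat sum.distrib sum_distrib_left algebra_simps)
    finally have "Tb \<beta> (Suc i) = D (Tb \<beta> i) + coord 0 * Ta \<beta> i"
      unfolding Suc by (simp add: vf.simps algebra_simps del: sum.atMost_Suc)
    with b show ?thesis by blast
  qed
qed

lemma (in derivation) Tab_eq_0:
  assumes "\<And>i. \<delta> (coord i) = 0"
  shows "\<delta> (Ta \<beta> i) = 0 \<and> \<delta> (Tb \<beta> i) = 0"
proof (induction i rule: less_induct)
  case (less i)
  then show ?case
    by (cases i) (auto simp: simps of_nat assms less_Suc_eq_le intro!: sum.neutral)
qed

section \<open>Holomorphy in the jet variables, and conjugation\<close>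

definition hol :: "sjet \<Rightarrow> bool" where
  "hol x \<longleftrightarrow> (\<forall>k. dub k x = 0)"

lemma du_cj: "du k (cj x) = cj (dub k x)" and dub_cj: "dub k (cj x) = cj (du k x)"
  and dz_cj: "dz (cj x) = cj (dzb x)" and dzb_cj: "dzb (cj x) = cj (dz x)" and dU_cj: "dU (cj x) = cj (dU x)"
  by (simp_all add: cj_wd cj_dc)

lemma du_eq_0_imp_vf: "(\<And>k. du k x = 0) \<Longrightarrow> vf c x = 0"
  by (simp add: vf_def)

lemma vf_cj_hol: "hol x \<Longrightarrow> vf c (cj x) = 0"
  by (rule du_eq_0_imp_vf) (simp add: du_cj hol_def)

lemma vf_zero_coeff: "vf (\<lambda>i. 0) x = 0"
  by (simp add: vf_def)

lemma hol_vf: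
  assumes "\<And>i. hol (c i)" "\<And>i. hol (du i x)"
  shows "hol (vf c x)"
  using assms by (auto simp: hol_def vf_def wd.simps)

lemma hol_Tab: "hol (Ta \<beta> i)" "hol (Tb \<beta> i)"
  using wd.Tab_eq_0[of \<i> "Re_u k" "Im_u k" for k] by (simp_all add: hol_def wd_coord)

lemma hol_coord: "hol (coord i)"
  by (simp add: hol_def wd_coord)

text \<open>\<open>tD\<close> is what remains of \<open>e\<^sub>-\<^sub>1\<close> on functions independent of \<open>u\<close> once the terms with \<open>T\<^sup>i\<close> are split off.\<close>

definition tD :: "sjet \<Rightarrow> sjet" where
  "tD x = dz x + D x"

lemma derivation_tD: "derivation tD"
  by standard (auto simp: tD_def wd.simps vf.simps algebra_simps)

interpretation tD: derivation tD by (rule derivation_tD)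

lemma D_comm_derivation:
  assumes "derivation \<delta>" "\<And>i x. \<delta> (du i x) = du i (\<delta> x)" "\<And>i. \<delta> (coord i) = 0"
  shows "\<delta> (D x) = D (\<delta> x)"
  by (simp add: vf_comm_derivation[OF assms(1,2)] assms(3) vf_zero_coeff)

lemma dU_D: "dU (D x) = D (dU x)" and dzb_D: "dzb (D x) = D (dzb x)"
  by (intro D_comm_derivation derivation_dc derivation_wd; simp add: wd_dc_commute wd_coord wd_commute)+

lemma dU_tD: "dU (tD x) = tD (dU x)"
  by (simp add: tD_def dc.simps dU_D wd_dc_commute)

text \<open>The last three conditions are the coefficients of \<open>1\<close>, \<open>f\<close> and \<open>f\<^sub>u\<close> in the (conjugated) equation.\<close>

definition solves :: "complex \<Rightarrow> sjet \<Rightarrow> bool" where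
  "solves \<beta> x \<longleftrightarrow> dU x = 0 \<and> (\<forall>i. hol (du i x)) \<and> tD (cj (tD x)) = 0
     \<and> vf (Ta \<beta>) (tD (cj x)) + cj (vf (Ta \<beta>) (tD x)) = 0
     \<and> vf (Tb \<beta>) (tD (cj x)) + cj (vf (Tb \<beta>) (tD x)) = cj x"

lemma hol_du_cj:
  assumes "\<And>i. hol (du i x)"
  shows "hol (du i (cj x))"
proof -
  have "dub j (du i (cj x)) = cj (dub i (du j x))" for j
    by (simp add: du_cj dub_cj wd_commute)
  then show ?thesis using assms by (simp add: hol_def)
qed

text \<open>Holomorphy of \<open>D (cj x)\<close> removes the term with two factors D. What remains
  makes the conjugation symmetry of the first condition in \<open>solves\<close> visible.\<close>

lemma tD_tD_cj:
  assumes "\<And>i. hol (du i x)"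
  shows "tD (cj (tD (cj x))) = dz (dzb x) + D (dzb x) + dz (cj (D (cj x)))"
proof -
  have "hol (D (cj x))" by (intro hol_vf hol_coord hol_du_cj assms)
  then have "D (cj (D (cj x))) = 0" by (rule vf_cj_hol)
  then show ?thesis by (simp add: tD_def wd.simps vf.simps dz_cj)
qed

text \<open>Conjugation exchanges weights d and -d. It also lets \<open>du\<close> reach the
  antiholomorphic part of a solution.\<close>

lemma solves_cj:
  assumes "solves \<beta> x"
  shows "solves \<beta> (cj x)"
proof -
  have m: "\<And>i. hol (du i x)" and "dU x = 0" and 1: "tD (cj (tD x)) = 0"
   and 2: "vf (Ta \<beta>) (tD (cj x)) + cj (vf (Ta \<beta>) (tD x)) = 0"
   and 3: "vf (Tb \<beta>) (tD (cj x)) + cj (vf (Tb \<beta>) (tD x)) = cj x"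
    using assms by (auto simp: solves_def)
  note m' = hol_du_cj[OF m]
  have "tD (cj (tD (cj x))) = dz (dzb x) + D (dzb x) + dz (cj (D (cj x)))"
    by (rule tD_tD_cj[OF m])
  also have "\<dots> = cj (dz (dzb (cj x)) + D (dzb (cj x)) + dz (cj (D (cj (cj x)))))"
    by (simp add: dz_cj dzb_cj dzb_D wd_commute flip: dz_cj)
      (simp add: dz_cj dzb_cj dzb_D)
  also have "\<dots> = 0"
    using tD_tD_cj[OF m'] 1 by simp
  finally have "tD (cj (tD (cj x))) = 0" .
  moreover have "vf (Ta \<beta>) (tD x) + cj (vf (Ta \<beta>) (tD (cj x))) = 0"
    using arg_cong[OF 2, of cj] by (simp add: add.commute)
  moreover have "vf (Tb \<beta>) (tD x) + cj (vf (Tb \<beta>) (tD (cj x))) = x"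
    using arg_cong[OF 3, of cj] by (simp add: add.commute)
  ultimately show ?thesis
    using m' \<open>dU x = 0\<close> by (simp add: solves_def dU_cj)
qed

section \<open>Reduction of the equation to three conditions free of f\<close>

locale jet_equation =
  fixes f f' :: "real \<Rightarrow> real" and \<beta> :: real
  assumes f: "\<And>u. (f has_real_derivative f' u) (at u)"
    and f': "\<And>u. (f' has_real_derivative \<beta> * f u) (at u)"
    and \<beta>: "\<beta> \<noteq> 0"
    and indep: "\<And>a b. (\<And>u. a * f u + b * f' u = 0) \<Longrightarrow> a = 0 \<and> b = 0"
begin

definition F :: "real \<Rightarrow> real \<Rightarrow> sjet" where
  "F a b = Sjet (\<lambda>(z, u, p). of_real (a * f u + b * f' u))"

lemma val_F: "val (F a b) = (\<lambda>(z, u, p). of_real (a * f u + b * f' u))"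
  unfolding F_def by (rule Sjet_inverse) (use smooth_jet_of_u[OF f f'] in blast)

lemma val_F' [simp]: "val (F a b) (z, u, p) = of_real (a * f u + b * f' u)"
  by (simp add: val_F)

lemma cj_F [simp]: "cj (F a b) = F a b"
  by (rule sjet_eqI) simp

lemma dc_F: "dc c (F a b) = (if c = U then F (b * \<beta>) a else 0)"
proof (rule sjet_eqI)
  fix z u p
  have d: "((\<lambda>u. complex_of_real (a * f u + b * f' u)) has_vector_derivative
         of_real (b * \<beta> * f u + a * f' u)) (at u)" for u
    by (rule has_vector_derivative_of_real_comp)
       (auto intro!: derivative_eq_intros f f')
  show "val (dc c (F a b)) (z, u, p) = val (if c = U then F (b * \<beta>) a else 0) (z, u, p)"
    unfolding val_dc val_F pd_of_u[OF d] by simp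
qed

lemma wd_F: "wd k Re_z Im_z (F a b) = 0" "wd k (Re_u i) (Im_u i) (F a b) = 0"
  by (simp_all add: wd_def dc_F)

lemma F_lin: "F a b = cst (of_real a) * F 1 0 + cst (of_real b) * F 0 1"
  by (rule sjet_eqI) simp

lemma dU_F: "dU (F 1 0) = F 0 1" "dU (F 0 1) = cst (of_real \<beta>) * F 1 0"
  unfolding dc_F by (simp_all add: F_lin[of \<beta> 0] cst_simps)

definition Tt :: "nat \<Rightarrow> sjet" where
  "Tt i = F 1 0 * Ta \<beta> i + F 0 1 * Tb \<beta> i"

lemma dU_Tab: "dU (Ta \<beta> i) = 0" "dU (Tb \<beta> i) = 0"
  using dc.Tab_eq_0[of U] by (simp_all add: wd_coord)

lemma dU_Tt: "dU (Tt i) = F 0 1 * Ta \<beta> i + cst (of_real \<beta>) * (F 1 0 * Tb \<beta> i)"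
  by (simp add: Tt_def dc.simps dU_F dU_Tab algebra_simps)

lemma D_F: "D (F a b) = 0"
  by (rule du_eq_0_imp_vf) (simp add: wd_F)

lemma Tt_Suc: "Tt (Suc i) = D (Tt i) + coord 0 * dU (Tt i)"
  unfolding dU_Tt unfolding Tt_def 
  by (simp add: Tab_Suc vf.simps D_F del: Ta.simps Tb.simps) (simp add: algebra_simps)

lemma T_eq: "T f i = val (Tt i)"
proof (induction i rule: less_induct)
  case (less i)
  show ?case
  proof (cases i)
    case 0
    then show ?thesis by (auto simp: Tt_def fun_eq_iff)
  next
    case (Suc k)
    have "pd U (T f j) = val (dU (Tt j))" if "j \<le> k" for j
      using less[of j] that Suc by (simp add: val_dc)
    then have "T f i (z, u, p) = val (\<Sum>j\<le>k. of_nat (k choose j) * coord (k - j) * dU (Tt j)) (z, u, p)" for z u p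
      by (simp add: Suc)
    moreover have "(\<Sum>j\<le>k. of_nat (k choose j) * coord (k - j) * dU (Tt j)) = Tt (Suc k)"
      unfolding dU_Tt unfolding Tt_def by (simp add: sum.distrib sum_distrib_left algebra_simps)
    ultimately show ?thesis by (auto simp: Suc fun_eq_iff)
  qed
qed

text \<open>The sum over conjugate derivatives is written as the conjugate of a holomorphic field
  acting on \<open>cj x\<close>, so that \<open>vf\<close> is the only kind of field needed.\<close>

definition eop :: "sjet \<Rightarrow> sjet" where
  "eop x = dz x + coord 0 * dU x + D x - cj (vf Tt (cj x))"

lemma e_minus_eq: "e_minus f (val x) = val (eop x)"
proof -
  have "e_minus f (val x) (z, u, p) = val (eop x) (z, u, p)" for z u p
  proof -
    let ?S = "{i. du i x \<noteq> 0}" and ?S' = "{i. du i (cj x) \<noteq> 0}"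
    have "(\<Sum>i. p (Suc i) * pd_u i (val x) (z, u, p)) = (\<Sum>i\<in>?S. p (Suc i) * pd_u i (val x) (z, u, p))"
      by (rule suminf_finite) (auto simp: finite_support_wd simp flip: val_wirtinger)
    moreover have "(\<Sum>i. cnj (T f i (z, u, p)) * pd_ubar i (val x) (z, u, p)) =
       (\<Sum>i\<in>?S'. cnj (T f i (z, u, p)) * pd_ubar i (val x) (z, u, p))"
      by (rule suminf_finite) (auto simp: finite_support_wd du_cj simp flip: val_wirtinger)
    ultimately show ?thesis
      by (simp add: eop_def vf_def T_eq val_dc cj_sum du_cj flip: val_wirtinger)
  qed
  then show ?thesis by auto
qed

lemma e_minus_bar_eq: "e_minus_bar f (val x) = val (cj (eop (cj x)))"
proof -
  have "(\<lambda>y. cnj (val x y)) = val (cj x)" by auto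
  then show ?thesis by (auto simp: e_minus_bar_def e_minus_eq)
qed

lemma vf_Tt: "vf Tt x = F 1 0 * vf (Ta \<beta>) x + F 0 1 * vf (Tb \<beta>) x"
  unfolding Tt_def by (rule vf_lin)

lemma wd_Tt: "dz (Tt i) = 0" "dub k (Tt i) = 0"
  using wd.Tab_eq_0[of "- \<i>" Re_z Im_z] wd.Tab_eq_0[of \<i> "Re_u k" "Im_u k"]
  by (simp_all add: Tt_def wd.simps wd_F wd_coord)

text \<open>T enters only linearly. Its quadratic terms vanish because mixed derivatives do, and the
  terms with derivatives of T^i cancel by T^{i+1} = D T^i + u_0 T^i_u. The left-hand side is the
  conjugate of the equation.\<close>

lemma eop_eop:
  assumes U: "dU x = 0" and m: "\<And>i. hol (du i x)"
  shows "eop (cj (eop x)) + F 0 1 * cj x = tD (cj (tD x))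
    - F 1 0 * (vf (Ta \<beta>) (tD (cj x)) + cj (vf (Ta \<beta>) (tD x)))
    - F 0 1 * (vf (Tb \<beta>) (tD (cj x)) + cj (vf (Tb \<beta>) (tD x)) - cj x)"
proof -
  define y where "y = cj x"
  have Uy: "dU y = 0" by (simp add: y_def dU_cj U)
  have my: "hol (du i y)" for i unfolding y_def by (rule hol_du_cj[OF m])
  define w where "w = cj (tD x) - vf Tt y"
  have e: "eop x = tD x - cj (vf Tt y)" by (simp add: eop_def U tD_def y_def)
  have w: "cj (eop x) = w" by (simp add: e w_def)
  have "hol (vf Tt y)" by (intro hol_vf my) (simp add: hol_def wd_Tt)
  then have 1: "vf Tt (cj w) = vf Tt (tD x)"
    by (simp add: w_def vf.simps vf_cj_hol)
  have 2: "dU w = - vf (\<lambda>i. dU (Tt i)) y"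
    by (simp add: w_def dc.simps dU_cj dU_tD U tD.simps Uy vf.simps
       vf_comm_derivation[OF derivation_dc wd_dc_commute[symmetric]])
  have 3: "tD (vf Tt y) = vf Tt (tD y) + vf (\<lambda>i. D (Tt i)) y - vf (\<lambda>i. Tt (Suc i)) y"
    using vf_commutator[of "\<lambda>i. coord (Suc i)" Tt y]
    by (simp add: tD_def vf_comm_derivation[OF derivation_wd wd_commute] wd_Tt vf_zero_coeff vf.simps)
  have 4: "vf (\<lambda>i. Tt (Suc i)) y = vf (\<lambda>i. D (Tt i)) y + coord 0 * vf (\<lambda>i. dU (Tt i)) y"
    unfolding Tt_Suc using vf_lin[of 1 "\<lambda>i. D (Tt i)" "coord 0" "\<lambda>i. dU (Tt i)" y] by simp
  have "eop w = tD w + coord 0 * dU w - cj (vf Tt (cj w))"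
    by (simp add: eop_def tD_def algebra_simps)
  also have "\<dots> = tD (cj (tD x)) - vf Tt (tD y) - cj (vf Tt (tD x))"
    unfolding 1 2 by (simp add: w_def tD.simps 3 4)
  finally show ?thesis
    unfolding w by (simp add: vf_Tt y_def algebra_simps)
qed

lemma dU_eq_0_val:
  assumes "dU x = 0"
  shows "val x (z, u, p) = val x (z, 0, p)"
proof -
  have "((\<lambda>s. val x (translate U s (z, 0, p))) has_vector_derivative 0) (at t)" for t
    using pdiff_has_derivative[OF smooth_jetD(3)[OF smooth_val], of x U "(z, 0, p)" t] assms
    by (simp flip: val_dc)
  then have "((\<lambda>s. val x (z, s, p)) has_vector_derivative 0) (at t within UNIV)" for t
    by simp
  then obtain c where "\<And>t. t \<in> UNIV \<Longrightarrow> val x (z, t, p) = c"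
    using has_vector_derivative_zero_constant[OF convex_UNIV] by blast
  then show ?thesis by simp
qed

text \<open>Differentiation removes the constant and leaves a relation between f and f' with
  coefficients c \<beta> and b; this is where \<beta> being nonzero is used.\<close>

lemma indep3_real:
  fixes a b c :: real
  assumes "\<And>u. a + b * f u + c * f' u = 0"
  shows "a = 0 \<and> b = 0 \<and> c = 0"
proof -
  have "((\<lambda>u. a + b * f u + c * f' u) has_real_derivative (c * \<beta> * f u + b * f' u)) (at u)" for u
    by (auto intro!: derivative_eq_intros f f')
  moreover have "((\<lambda>u. a + b * f u + c * f' u) has_real_derivative 0) (at u)" for u
    unfolding assms by simp
  ultimately have "c * \<beta> * f u + b * f' u = 0" for u
    by (rule DERIV_unique)
  then have "c * \<beta> = 0 \<and> b = 0" by (rule indep)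
  then show ?thesis using assms \<beta> by auto
qed

lemma indep3:
  fixes a b c :: complex
  assumes *: "\<And>u. a + of_real (f u) * b + of_real (f' u) * c = 0"
  shows "a = 0 \<and> b = 0 \<and> c = 0"
proof -
  have "Re a + Re b * f u + Re c * f' u = 0" "Im a + Im b * f u + Im c * f' u = 0" for u
    using arg_cong[OF *[of u], of Re] arg_cong[OF *[of u], of Im] by (simp_all add: mult.commute)
  then show ?thesis
    using indep3_real[of "Re a" "Re b" "Re c"] indep3_real[of "Im a" "Im b" "Im c"]
    by (simp add: complex_eq_iff)
qed

lemma indep3_sjet:
  assumes U: "dU a = 0" "dU b = 0" "dU c = 0"
  shows "a + F 1 0 * b + F 0 1 * c = 0 \<longleftrightarrow> a = 0 \<and> b = 0 \<and> c = 0"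
proof
  assume *: "a + F 1 0 * b + F 0 1 * c = 0"
  have "val a (z, u, p) = 0 \<and> val b (z, u, p) = 0 \<and> val c (z, u, p) = 0" for z u p
  proof -
    have "val a (z, v, p) + of_real (f v) * val b (z, v, p) + of_real (f' v) * val c (z, v, p) = 0" for v
      using arg_cong[OF *, of "\<lambda>x. val x (z, v, p)"] by simp
    then show ?thesis
      using indep3[of "val a (z, 0, p)" "val b (z, 0, p)" "val c (z, 0, p)"] U dU_eq_0_val by metis
  qed
  then show "a = 0 \<and> b = 0 \<and> c = 0"
    by (auto intro!: sjet_eqI)
qed auto

lemma dU_vf_Tab:
  assumes "dU x = 0"
  shows "dU (vf (Ta \<beta>) x) = 0" "dU (vf (Tb \<beta>) x) = 0"
  by (simp_all add: vf_comm_derivation[OF derivation_dc wd_dc_commute[symmetric]] dU_Tab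
      vf_zero_coeff assms vf.zero)

text \<open>The function f is gone from the right-hand side: existence and uniqueness become
  statements about \<beta> alone.\<close>

lemma val_mem_V_iff: "val x \<in> V f d \<longleftrightarrow> weighted_degree d (val x) \<and> solves \<beta> x"
proof -
  have "deriv f = f'" using f by (auto intro!: DERIV_imp_deriv)
  have E: "(\<forall>z u p. e_minus_bar f (e_minus f (val x)) (z, u, p) + of_real (deriv f u) * val x (z, u, p) = 0)
      \<longleftrightarrow> eop (cj (eop x)) + F 0 1 * cj x = 0"
  proof -
    have "e_minus_bar f (e_minus f (val x)) (z, u, p) + of_real (deriv f u) * val x (z, u, p)
        = val (cj (eop (cj (eop x)) + F 0 1 * cj x)) (z, u, p)" for z u p
      by (simp add: e_minus_eq e_minus_bar_eq \<open>deriv f = f'\<close>)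
    then have "?thesis \<longleftrightarrow> ((\<forall>z u p. val (cj (eop (cj (eop x)) + F 0 1 * cj x)) (z, u, p) = val 0 (z, u, p))
       \<longleftrightarrow> cj (eop (cj (eop x)) + F 0 1 * cj x) = 0)"
      by (simp only: cj_eq_0 val_simps)
    then show ?thesis by (auto intro: sjet_eqI simp only:)
  qed
  have U: "(\<forall>y. pd U (val x) y = 0) \<longleftrightarrow> dU x = 0"
    by (auto simp flip: val_dc intro!: sjet_eqI)
  have m: "(\<forall>i j y. pd_ubar j (pd_u i (val x)) y = 0) \<longleftrightarrow> (\<forall>i. hol (du i x))"
  proof -
    have "pd_u i (val x) = val (du i x)" for i by (auto simp: val_wirtinger)
    then show ?thesis
      by (auto simp: hol_def simp flip: val_wirtinger intro!: sjet_eqI)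
  qed
  have "eop (cj (eop x)) + F 0 1 * cj x = 0 \<longleftrightarrow> tD (cj (tD x)) = 0
     \<and> vf (Ta \<beta>) (tD (cj x)) + cj (vf (Ta \<beta>) (tD x)) = 0
     \<and> vf (Tb \<beta>) (tD (cj x)) + cj (vf (Tb \<beta>) (tD x)) = cj x"
    if x: "dU x = 0" "\<And>i. hol (du i x)"
  proof -
    have "eop (cj (eop x)) + F 0 1 * cj x = tD (cj (tD x))
      + F 1 0 * (- (vf (Ta \<beta>) (tD (cj x)) + cj (vf (Ta \<beta>) (tD x))))
      + F 0 1 * (- (vf (Tb \<beta>) (tD (cj x)) + cj (vf (Tb \<beta>) (tD x)) - cj x))"
      unfolding eop_eop[OF x] by (simp only: diff_conv_add_uminus mult_minus_right)
    also have "\<dots> = 0 \<longleftrightarrow> tD (cj (tD x)) = 0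
      \<and> - (vf (Ta \<beta>) (tD (cj x)) + cj (vf (Ta \<beta>) (tD x))) = 0
      \<and> - (vf (Tb \<beta>) (tD (cj x)) + cj (vf (Tb \<beta>) (tD x)) - cj x) = 0"
      by (rule indep3_sjet)
        (simp_all add: dc.simps dU_tD dU_cj dU_vf_Tab x tD.simps)
    finally show ?thesis by (simp only: neg_equal_0_iff_equal right_minus_eq)
  qed
  then show ?thesis
    unfolding V_def solves_def mem_Collect_eq E U m by auto
qed

end

section \<open>Order of vanishing\<close>

definition ev0 :: "sjet \<Rightarrow> bool" where
  "ev0 x \<longleftrightarrow> (\<forall>z u. val x (z, u, \<lambda>_. 0) = 0)"

text \<open>Only the holomorphic derivatives are tested; conjugate ones are treated by passing to \<open>cj x\<close>.\<close>

primrec vanish :: "nat \<Rightarrow> sjet \<Rightarrow> bool" where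
  "vanish 0 x = True"
| "vanish (Suc k) x = (ev0 x \<and> (\<forall>i. vanish k (du i x)))"

lemma ev0_simps [simp]: "ev0 0" "ev0 (coord i)" "ev0 x \<Longrightarrow> ev0 (x * y)" "ev0 y \<Longrightarrow> ev0 (x * y)"
  "ev0 x \<Longrightarrow> ev0 (- x)" "ev0 x \<Longrightarrow> ev0 y \<Longrightarrow> ev0 (x + y)" "ev0 x \<Longrightarrow> ev0 y \<Longrightarrow> ev0 (x - y)" "ev0 (cj x) = ev0 x"
  by (auto simp: ev0_def)

lemma ev0_sum: "(\<And>i. i \<in> S \<Longrightarrow> ev0 (g i)) \<Longrightarrow> ev0 (sum g S)"
  by (induction S rule: infinite_finite_induct) auto

lemma ev0_vf: "(\<And>i. ev0 (c i)) \<Longrightarrow> ev0 (vf c x)"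
  unfolding vf_def by (auto intro!: ev0_sum)

lemma ev0_dc:
  assumes "ev0 x" "c = Re_z \<or> c = Im_z \<or> c = U"
  shows "ev0 (dc c x)"
proof -
  have "(\<lambda>t. val x (translate c t (z, u, \<lambda>_. 0))) = (\<lambda>t. 0)" for z u
    using assms by (auto simp: ev0_def)
  then show ?thesis by (simp add: ev0_def val_dc pd_def)
qed

lemma ev0_wd: "ev0 x \<Longrightarrow> ev0 (wd k Re_z Im_z x)"
  by (simp add: wd_def ev0_dc)

lemma vanish_add: "vanish k x \<Longrightarrow> vanish k y \<Longrightarrow> vanish k (x + y)"
  by (induction k arbitrary: x y) (auto simp: wd.simps)

lemma vanish_zero [simp]: "vanish k 0"
  by (induction k) (auto simp: wd.simps)

lemma vanish_minus: "vanish k x \<Longrightarrow> vanish k (- x)"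
  by (induction k arbitrary: x) (auto simp: wd.simps)

lemma vanish_diff: "vanish k x \<Longrightarrow> vanish k y \<Longrightarrow> vanish k (x - y)"
  using vanish_add[of k x "- y"] vanish_minus by simp

lemma vanish_sum: "(\<And>i. i \<in> S \<Longrightarrow> vanish k (g i)) \<Longrightarrow> vanish k (sum g S)"
  by (induction S rule: infinite_finite_induct) (auto intro: vanish_add)

lemma vanish_Suc_D: "vanish (Suc k) x \<Longrightarrow> vanish k x"
  by (induction k arbitrary: x) auto

lemma vanish_mono: "vanish k x \<Longrightarrow> l \<le> k \<Longrightarrow> vanish l x"
  by (induction k) (auto simp: le_Suc_eq dest: vanish_Suc_D simp del: vanish.simps(2))

lemma vanish_1 [simp]: "vanish (Suc 0) x = ev0 x"
  by simp

lemma vanish_mult: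
  "vanish j x \<Longrightarrow> vanish k y \<Longrightarrow> vanish (j + k) (x * y)"
proof (induction "j + k" arbitrary: j k x y)
  case (Suc n)
  have "ev0 (x * y)" using Suc.hyps(2) Suc.prems by (cases j; cases k) auto
  moreover have "vanish n (du i (x * y))" for i
  proof -
    have "vanish n (du i x * y)"
    proof (cases j)
      case 0
      then show ?thesis
        using Suc.hyps(1)[of 0 n "du i x" y] Suc.hyps(2) Suc.prems(2) vanish_mono[of k y n] by simp
    next
      case (Suc j')
      then show ?thesis
        using Suc.hyps(1)[of j' k "du i x" y] Suc.hyps(2) Suc.prems by simp
    qed
    moreover have "vanish n (x * du i y)"
    proof (cases k)
      case 0
      then show ?thesis
        using Suc.hyps(1)[of n 0 x "du i y"] Suc.hyps(2) Suc.prems(1) vanish_mono[of j x n] by simp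
    next
      case (Suc k')
      then show ?thesis
        using Suc.hyps(1)[of j k' x "du i y"] Suc.hyps(2) Suc.prems by simp
    qed
    ultimately show ?thesis by (simp add: wd.mult vanish_add)
  qed
  ultimately show ?case
    using Suc.hyps(2)[symmetric] by simp
qed auto

lemma vanish_mult_left: "vanish k y \<Longrightarrow> vanish k (x * y)"
  using vanish_mult[of 0 x k y] by simp

lemma vanish_vf:
  assumes "\<And>i. vanish j (c i)" "\<And>i. vanish k (du i x)"
  shows "vanish (j + k) (vf c x)"
  unfolding vf_def by (intro vanish_sum vanish_mult assms)

lemma vanish_vf_1:
  assumes "\<And>i. ev0 (c i)" "vanish k x"
  shows "vanish k (vf c x)"
proof (cases k)
  case (Suc l)
  then show ?thesis
    using vanish_vf[of "Suc 0" c l x] assms by simp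
qed simp

lemma vanish_wd: "vanish m x \<Longrightarrow> vanish m (wd k Re_z Im_z x)"
  by (induction m arbitrary: x) (auto simp: ev0_wd wd_commute[of _ "Re_u _"])

lemma vanish_tD: "vanish k x \<Longrightarrow> vanish k (tD x)"
  unfolding tD_def by (intro vanish_add vanish_wd vanish_vf_1) auto

section \<open>Commutators with D and descent on the index\<close>

lemma vf_delta: "vf (\<lambda>i. if i = j then 1 else 0) x = du j x"
proof -
  have "vf (\<lambda>i. if i = j then 1 else 0) x = (\<Sum>i\<in>insert j {i. du i x \<noteq> 0}. (if i = j then 1 else 0) * du i x)"
    by (rule vf_eq) (auto simp: finite_support_wd)
  also have "\<dots> = (\<Sum>i\<in>insert j {i. du i x \<noteq> 0}. if i = j then du i x else 0)"
    by (intro sum.cong) auto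
  also have "\<dots> = du j x"
    by (subst sum.delta) (auto simp: finite_support_wd)
  finally show ?thesis .
qed

lemma du_vf: "du k (vf c x) = vf (\<lambda>i. du k (c i)) x + vf c (du k x)"
  by (rule vf_comm_derivation[OF derivation_wd wd_commute])

lemma du_D: "du 0 (D x) = D (du 0 x)" "du (Suc k) (D x) = D (du (Suc k) x) + du k x"
  using vf_delta[of k x] vf_zero_coeff[of x]
  by (simp_all add: du_vf wd_coord eq_commute[of k] cong: if_cong)

lemma du_tD: "du 0 (tD x) = tD (du 0 x)" "du (Suc k) (tD x) = tD (du (Suc k) x) + du k x"
  unfolding tD_def wd.add du_D by (simp_all add: wd_commute[of _ "Re_u _"] algebra_simps)

text \<open>Induction from above: dependence on finitely many coordinates settles all large
  indices.\<close>

lemma descend: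
  assumes "finite {i. \<not> P i}" and step: "\<And>i. P (Suc i) \<Longrightarrow> P i"
  shows "P (i :: nat)"
proof (rule ccontr)
  assume "\<not> P i"
  then have "\<not> P (i + n)" for n
    by (induction n) (use step in auto)
  then have "range (\<lambda>n. i + n) \<subseteq> {i. \<not> P i}" by auto
  then have "finite (range (\<lambda>n. i + n))" using assms(1) finite_subset by blast
  then show False by (simp add: finite_image_iff inj_on_def)
qed

lemma finite_du_vanish: "finite {i. \<not> vanish k (du i x)}"
  by (rule finite_subset[OF _ finite_support_wd[of "- \<i>" x]]) auto

text \<open>Since d/du_{i+1} tD x = tD (d/du_{i+1} x) + d/du_i x, control of d/du_{i+1} x passes
  down to d/du_i x.\<close>

lemma tD_inj:
  assumes "\<And>i. vanish k (du i (tD x))"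
  shows "vanish k (du i x)"
proof (rule descend[OF finite_du_vanish])
  fix i assume "vanish k (du (Suc i) x)"
  then show "vanish k (du i x)"
    using assms[of "Suc i"] vanish_diff[of k "du (Suc i) (tD x)" "tD (du (Suc i) x)"] vanish_tD
    by (simp add: du_tD)
qed

lemma D_eq_0_imp:
  assumes "D x = 0"
  shows "du i x = 0"
proof (rule descend[of "\<lambda>i. du i x = 0"])
  show "finite {i. du i x \<noteq> 0}" by (rule finite_support_wd)
  fix i assume "du (Suc i) x = 0"
  then show "du i x = 0"
    using du_D(2)[of i x] by (simp add: assms wd.zero vf.zero)
qed

lemma val_coord_const:
  assumes "du k x = 0" "dub k x = 0"
  shows "val x (z, u, p(k := \<zeta>)) = val x (z, u, p)"
proof -
  have "((\<lambda>\<zeta>. val x (z, u, p(k := \<zeta>))) has_derivative (\<lambda>h. 0)) (at \<zeta> within UNIV)" for \<zeta>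
    using has_derivative_coord[OF smooth_val, of x z u p k \<zeta>] dc_eq_0[OF assms]
    by (simp flip: val_dc)
  then have "val x (z, u, p(k := \<zeta>)) = val x (z, u, p(k := p k))"
    by (rule has_derivative_zero_unique[OF convex_UNIV]) auto
  then show ?thesis by simp
qed

lemma val_eq_at_0:
  assumes "\<And>k. du k x = 0" "\<And>k. dub k x = 0"
  shows "val x (z, u, p) = val x (z, u, \<lambda>_. 0)"
proof -
  obtain n where n: "\<And>z u p q. (\<forall>i<n. p i = q i) \<Longrightarrow> val x (z, u, p) = val x (z, u, q)"
    using smooth_jetD(1)[OF smooth_val[of x]] unfolding finitely_many_coords_def by metis
  have "val x (z, u, \<lambda>i. if i < m then p i else 0) = val x (z, u, \<lambda>_. 0)" for m
  proof (induction m)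
    case (Suc m)
    have "(\<lambda>i. if i < Suc m then p i else 0) = (\<lambda>i. if i < m then p i else 0)(m := p m)"
      by (auto simp: fun_eq_iff less_Suc_eq)
    then show ?case using Suc val_coord_const[OF assms] by simp
  qed simp
  from this[of n] show ?thesis using n[of p "\<lambda>i. if i < n then p i else 0" z u] by simp
qed

section \<open>Existence\<close>

text \<open>Weighted homogeneous polynomials in the u_i, where u_i counts i + 1 as in
  \<open>weighted_degree\<close>. The zero polynomial has every weight, so that each weight is
  closed under subtraction.\<close>

inductive homog :: "nat \<Rightarrow> sjet \<Rightarrow> bool" where
  cst: "homog 0 (cst k)"
| zero: "homog d 0"
| coord: "homog (Suc i) (coord i)"
| add: "homog d x \<Longrightarrow> homog d y \<Longrightarrow> homog d (x + y)"
| mult: "homog d x \<Longrightarrow> homog e y \<Longrightarrow> homog (d + e) (x * y)"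

lemma homog_const:
  assumes "homog d x"
  shows "dU x = 0" "dz x = 0" "dzb x = 0" "hol x"
  using assms
  by (induction; simp add: hol_def wd.simps dc.simps wd_coord)+

lemma homog_ev0: "homog d x \<Longrightarrow> d > 0 \<Longrightarrow> ev0 x"
  by (induction rule: homog.induct) auto

lemma homog_D: "homog d x \<Longrightarrow> homog (Suc d) (D x)"
proof (induction rule: homog.induct)
  case (mult d x e y)
  have "homog (Suc (d + e)) (D x * y)" "homog (Suc (d + e)) (x * D y)"
    using homog.mult[of "Suc d" "D x" e y] homog.mult[of d x "Suc e" "D y"] mult by simp_all
  then show ?case by (simp add: vf.mult homog.add)
qed (auto simp: vf.simps intro: homog.intros)

lemma homog_weight:
  assumes "homog d x"
  shows "val x (w, u, \<lambda>j. l ^ (j + 1) * p j) = l ^ d * val x (z, u, p)"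
  using assms by (induction) (auto simp: algebra_simps power_add)

lemma homog_cst_mult: "homog d x \<Longrightarrow> homog d (cst k * x)"
  using homog.mult[OF homog.cst] by simp

lemma homog_minus: "homog d x \<Longrightarrow> homog d (- x)"
  using homog_cst_mult[of d x "-1"] by (simp add: cst_simps)

lemma homog_diff: "homog d x \<Longrightarrow> homog d y \<Longrightarrow> homog d (x - y)"
  using homog.add[of d x "- y"] homog_minus by simp

lemma homog_sum: "(\<And>i. i \<in> S \<Longrightarrow> homog d (g i)) \<Longrightarrow> homog d (sum g S)"
  by (induction S rule: infinite_finite_induct) (auto intro: homog.intros)

lemma homog_mult': "homog d x \<Longrightarrow> homog e y \<Longrightarrow> n = d + e \<Longrightarrow> homog n (x * y)"
  using homog.mult by simp

lemma homog_one: "homog 0 1"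
  using homog.cst[of 1] by (simp add: cst_simps)

text \<open>Positive weight rules out a constant of integration.\<close>

lemma homog_eq_0I:
  assumes "homog d x" "d > 0" "D x = 0"
  shows "x = 0"
proof (rule sjet_eqI)
  fix z u p
  have "val x (z, u, p) = val x (z, u, \<lambda>_. 0)"
    using homog_const(4)[OF assms(1)] D_eq_0_imp[OF assms(3)] by (intro val_eq_at_0) (auto simp: hol_def)
  then show "val x (z, u, p) = val 0 (z, u, p)"
    using homog_ev0[OF assms(1,2)] by (simp add: ev0_def)
qed

text \<open>Coefficients of \<open>\<lambda>\<^sup>-\<^sup>n\<close> in the solution of \<open>2 K K'' - K'\<^sup>2 + 2 q K\<^sup>2 = \<lambda> (K\<^sup>2 - 1)\<close>, a first integral of
  \<open>K''' + 2 q K' + q' K = \<lambda> K'\<close>; in contrast to the Lenard recursion it involves no integration.\<close>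

function lenard_poly :: "sjet \<Rightarrow> nat \<Rightarrow> sjet" where
  "lenard_poly q 0 = 1"
| "lenard_poly q (Suc n) = cst (1 / 2) *
    ((\<Sum>i\<in>{..n}. 2 * lenard_poly q i * D (D (lenard_poly q (n - i))) - D (lenard_poly q i) * D (lenard_poly q (n - i)) + 2 * q * lenard_poly q i * lenard_poly q (n - i))
     - (\<Sum>i\<in>{..<n}. lenard_poly q (Suc i) * lenard_poly q (n - i)))"
  by pat_completeness auto
termination
  by (relation "Wellfounded.measure snd") auto

declare lenard_poly.simps(2) [simp del]

lemma half: "cst (1 / 2) * (2 * x) = x" "2 * (cst (1 / 2) * x) = x"
  by (rule sjet_eqI; simp)+

lemma two_cancel: "2 * x = 0 \<Longrightarrow> x = (0 :: sjet)"
  using half(1)[of x] by simp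

text \<open>The coefficient form of the quadratic equation. As K_0 = 1, the new polynomial occurs in
  the square twice, at both ends of the sum, which explains the factor 1/2 in the recursion.\<close>

lemma lenard_poly_convolution:
  "(\<Sum>i\<le>Suc n. lenard_poly q i * lenard_poly q (Suc n - i)) =
   (\<Sum>i\<le>n. 2 * lenard_poly q i * D (D (lenard_poly q (n - i))) - D (lenard_poly q i) * D (lenard_poly q (n - i)) + 2 * q * lenard_poly q i * lenard_poly q (n - i))"
   (is "_ = ?N")
proof -
  have "(\<Sum>i\<le>Suc n. lenard_poly q i * lenard_poly q (Suc n - i)) = lenard_poly q (Suc n) + (\<Sum>i\<le>n. lenard_poly q (Suc i) * lenard_poly q (n - i))"
    by (subst sum.atMost_Suc_shift) simp
  also have "(\<Sum>i\<le>n. lenard_poly q (Suc i) * lenard_poly q (n - i)) = (\<Sum>i<n. lenard_poly q (Suc i) * lenard_poly q (n - i)) + lenard_poly q (Suc n)"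
    by (simp flip: lessThan_Suc_atMost)
  also have "lenard_poly q (Suc n) + ((\<Sum>i<n. lenard_poly q (Suc i) * lenard_poly q (n - i)) + lenard_poly q (Suc n)) =
      2 * lenard_poly q (Suc n) + (\<Sum>i<n. lenard_poly q (Suc i) * lenard_poly q (n - i))"
    by (simp only: mult_2 add_ac)
  also have "\<dots> = ?N"
    by (simp add: lenard_poly.simps(2)[of q n] half)
  finally show ?thesis .
qed

lemma sum_atMost_flip: "(\<Sum>i\<le>n. g i (n - i)) = (\<Sum>i\<le>n. g (n - i) (i::nat))"
  by (rule sum.reindex_bij_witness[of _ "\<lambda>i. n - i" "\<lambda>i. n - i"]) auto

text \<open>The second Hamiltonian operator of KdV; the Lenard recursion pairs it with D.\<close>

definition lenard_op :: "sjet \<Rightarrow> sjet \<Rightarrow> sjet" where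
  "lenard_op q k = D (D (D k)) + 2 * q * D k + D q * k"

lemma (in derivation) numeral: "\<delta> (numeral n) = 0"
  using of_nat[of "numeral n"] by simp

text \<open>The derivative of the first integral is 2 K times the linear third-order equation. In
  the resulting convolution the induction hypothesis removes all terms but i = 0, where K_0 =
  1.\<close>

lemma lenard_recursion: "D (lenard_poly q (Suc n)) = lenard_op q (lenard_poly q n)"
proof (induction n rule: less_induct)
  case (less n)
  let ?K = "lenard_poly q"
  have "D (\<Sum>i\<le>Suc n. ?K i * ?K (Suc n - i)) =
      (\<Sum>i\<le>Suc n. D (?K i) * ?K (Suc n - i)) + (\<Sum>i\<le>Suc n. ?K i * D (?K (Suc n - i)))"
    by (simp only: vf.sum vf.mult sum.distrib)
  also have "(\<Sum>i\<le>Suc n. D (?K i) * ?K (Suc n - i)) = (\<Sum>i\<le>Suc n. ?K i * D (?K (Suc n - i)))"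
    using sum_atMost_flip[of "\<lambda>i j. D (?K i) * ?K j" "Suc n"] by (simp only: mult.commute)
  \<comment> \<open>The last summand contains D K_0 = 0, hence the shorter range.\<close>
  finally have L: "D (\<Sum>i\<le>Suc n. ?K i * ?K (Suc n - i)) = 2 * (\<Sum>i\<le>n. ?K i * D (?K (Suc (n - i))))"
    by (simp add: Suc_diff_le vf.one)
  have "D (\<Sum>i\<le>Suc n. ?K i * ?K (Suc n - i)) =
     (\<Sum>i\<le>n. 2 * (?K i * (D (D (D (?K (n - i)))) + q * D (?K (n - i)) + D q * ?K (n - i))))
     + (\<Sum>i\<le>n. D (?K i) * D (D (?K (n - i)))) - (\<Sum>i\<le>n. D (D (?K i)) * D (?K (n - i)))
     + (\<Sum>i\<le>n. 2 * q * (D (?K i) * ?K (n - i)))"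
    unfolding lenard_poly_convolution
    by (simp add: vf.simps vf.numeral sum.distrib sum_subtractf sum_distrib_left algebra_simps)
  \<comment> \<open>Reversing the index makes the two sums of products of a first and a second
    derivative cancel.\<close>
  also have "(\<Sum>i\<le>n. D (D (?K i)) * D (?K (n - i))) = (\<Sum>i\<le>n. D (?K i) * D (D (?K (n - i))))"
    using sum_atMost_flip[of "\<lambda>i j. D (D (?K i)) * D (?K j)" n] by (simp only: mult.commute)
  also have "(\<Sum>i\<le>n. 2 * q * (D (?K i) * ?K (n - i))) = (\<Sum>i\<le>n. 2 * q * (?K i * D (?K (n - i))))"
    using sum_atMost_flip[of "\<lambda>i j. 2 * q * (D (?K i) * ?K j)" n] by (simp only: mult.commute)
  finally have "D (\<Sum>i\<le>Suc n. ?K i * ?K (Suc n - i)) = 2 * (\<Sum>i\<le>n. ?K i * lenard_op q (?K (n - i)))"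
    by (simp add: lenard_op_def sum.distrib sum_distrib_left algebra_simps)
  with L have "2 * (\<Sum>i\<le>n. ?K i * (D (?K (Suc (n - i))) - lenard_op q (?K (n - i)))) = 0"
    by (simp only: right_diff_distrib sum_subtractf) simp
  then have "(\<Sum>i\<le>n. ?K i * (D (?K (Suc (n - i))) - lenard_op q (?K (n - i)))) = 0"
    by (rule two_cancel)
  moreover have "(\<Sum>i\<le>n. ?K i * (D (?K (Suc (n - i))) - lenard_op q (?K (n - i)))) =
      (\<Sum>i\<in>{0}. ?K i * (D (?K (Suc (n - i))) - lenard_op q (?K (n - i))))"
    by (rule sum.mono_neutral_right) (auto simp: less)
  ultimately show ?case by simp
qed

lemma homog_lenard_poly:
  assumes "homog 2 q"
  shows "homog (2 * n) (lenard_poly q n)"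
proof (induction n rule: less_induct)
  case (less n)
  show ?case
  proof (cases n)
    case 0
    then show ?thesis by (simp add: homog_one)
  next
    case (Suc m)
    have IH: "homog (2 * i) (lenard_poly q i)" if "i \<le> m" for i
      using less[of i] that Suc by simp
    have two: "2 * x = cst 2 * x" for x by (simp add: cst_2)
    have h: "homog (2 * Suc m) (cst 2 * (lenard_poly q i * D (D (lenard_poly q (m - i)))))"
      "homog (2 * Suc m) (D (lenard_poly q i) * D (lenard_poly q (m - i)))"
      "homog (2 * Suc m) (cst 2 * (q * (lenard_poly q i * lenard_poly q (m - i))))" if "i \<le> m" for i
    proof -
      have l: "homog (2 * (m - i)) (lenard_poly q (m - i))" by (rule IH) simp
      show "homog (2 * Suc m) (cst 2 * (lenard_poly q i * D (D (lenard_poly q (m - i)))))"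
        by (rule homog_cst_mult[OF homog_mult'[OF IH homog_D[OF homog_D[OF l]]]]) (use that in simp_all)
      show "homog (2 * Suc m) (D (lenard_poly q i) * D (lenard_poly q (m - i)))"
        by (rule homog_mult'[OF homog_D[OF IH] homog_D[OF l]]) (use that in simp_all)
      show "homog (2 * Suc m) (cst 2 * (q * (lenard_poly q i * lenard_poly q (m - i))))"
        by (rule homog_cst_mult[OF homog_mult'[OF assms homog_mult'[OF IH l]]]) (use that in simp_all)
    qed
    have h': "homog (2 * Suc m) (lenard_poly q (Suc i) * lenard_poly q (m - i))" if "i < m" for i
      by (rule homog_mult'[OF IH IH]) (use that in simp_all)
    show ?thesis
      unfolding Suc lenard_poly.simps(2)[of q m] two mult.assoc
      by (intro homog_cst_mult[of _ _ "1 / 2"] homog_diff homog_sum homog.add h h') simp_all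
  qed
qed

section \<open>The Miura transform and the flows\<close>

definition miura :: "complex \<Rightarrow> sjet" where
  "miura \<omega> = cst \<omega> * coord 1 - cst (1 / 2) * (cst \<omega> * coord 0 * (cst \<omega> * coord 0))"

text \<open>Up to the factor w these are the potential mKdV flows, the higher symmetries of
  equations of sinh-Gordon type. The first two are w u_0 and w (u_2 - w^2 u_0^3 / 2).\<close>

definition flow :: "complex \<Rightarrow> nat \<Rightarrow> sjet" where
  "flow \<omega> n = D (lenard_poly (miura \<omega>) n) + cst \<omega> * coord 0 * lenard_poly (miura \<omega>) n"

text \<open>For f = exp(w u), which satisfies f_uu = w^2 f, this is the field with coefficients T^i
  divided by f. The factor 1 fits the shape of \<open>vf_lin\<close>.\<close>

definition char_vf :: "complex \<Rightarrow> sjet \<Rightarrow> sjet" where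
  "char_vf \<omega> = vf (\<lambda>i. 1 * Ta (\<omega> * \<omega>) i + cst \<omega> * Tb (\<omega> * \<omega>) i)"

lemma char_vf_eq: "char_vf \<omega> x = vf (Ta (\<omega> * \<omega>)) x + cst \<omega> * vf (Tb (\<omega> * \<omega>)) x"
  unfolding char_vf_def vf_lin by simp

interpretation char_vf: derivation "char_vf \<omega>" for \<omega>
  unfolding char_vf_def by (rule derivation_vf)

text \<open>The coefficients satisfy c_{i+1} = (D + w u_0) c_i, so in the commutator their
  derivatives cancel and only the multiple of u_0 survives.\<close>

lemma char_vf_D: "char_vf \<omega> (D x) = D (char_vf \<omega> x) + cst \<omega> * coord 0 * char_vf \<omega> x"
proof -
  define c where "c i = 1 * Ta (\<omega> * \<omega>) i + cst \<omega> * Tb (\<omega> * \<omega>) i" for i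
  have X: "char_vf \<omega> = vf c" by (simp add: char_vf_def c_def[abs_def])
  have c: "c (Suc i) = 1 * D (c i) + cst \<omega> * coord 0 * c i" for i
    by (simp add: c_def Tab_Suc vf.simps cst_simps algebra_simps del: Ta.simps Tb.simps)
  have "vf (\<lambda>i. c (Suc i)) x = 1 * vf (\<lambda>i. D (c i)) x + cst \<omega> * coord 0 * vf c x"
    unfolding c by (rule vf_lin)
  then show ?thesis
    using vf_commutator[of c "\<lambda>i. coord (Suc i)" x] by (simp add: X)
qed

lemma char_vf_coord_0: "char_vf \<omega> (coord 0) = 1"
  by (simp add: char_vf_def)

lemma char_vf_miura: "char_vf \<omega> (miura \<omega>) = 0"
proof -
  have "coord 1 = D (coord 0)" by simp
  then have "char_vf \<omega> (coord 1) = cst \<omega> * coord 0"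
    by (simp only: char_vf_D char_vf_coord_0 vf.one) simp
  then show ?thesis
    unfolding miura_def by (simp add: char_vf.simps char_vf_coord_0 half(2)[of 1, simplified] mult.left_commute flip: mult_2)
qed

lemma char_vf_lenard_poly: "char_vf \<omega> (lenard_poly (miura \<omega>) n) = 0"
proof (induction n rule: less_induct)
  case (less n)
  show ?case
  proof (cases n)
    case 0
    then show ?thesis by (simp add: char_vf.one)
  next
    case (Suc m)
    have IH: "char_vf \<omega> (lenard_poly (miura \<omega>) i) = 0" if "i \<le> m" for i
      using less[of i] that Suc by simp
    have d: "char_vf \<omega> (D x) = 0" if "char_vf \<omega> x = 0" for x
      by (simp add: char_vf_D that vf.zero)
    show ?thesis
      unfolding Suc lenard_poly.simps(2)[of _ m]
      by (simp add: char_vf.simps char_vf.numeral char_vf_miura IH d)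
  qed
qed

text \<open>X_w annihilates K and D K and sends u_0 to 1, so X_w A = w K; moving X_w past D turns
  this into w (D + w u_0) K.\<close>

lemma char_vf_flow: "char_vf \<omega> (D (flow \<omega> n)) = cst \<omega> * flow \<omega> n"
proof -
  have "char_vf \<omega> (flow \<omega> n) = cst \<omega> * lenard_poly (miura \<omega>) n"
    by (simp add: flow_def char_vf.simps char_vf_D char_vf_lenard_poly char_vf_coord_0 vf.zero)
  then show ?thesis
    by (simp add: char_vf_D vf.cst_mult) (simp add: flow_def algebra_simps)
qed

lemma homog_miura: "homog 2 (miura \<omega>)"
proof -
  have 0: "homog 1 (coord 0)" and 1: "homog 2 (coord 1)"
    using homog.coord[of 0] homog.coord[of 1] by (simp_all add: numeral_2_eq_2)
  show ?thesis
    unfolding miura_def by (intro homog_diff homog_cst_mult 1 homog_mult'[OF homog_cst_mult[OF 0] homog_cst_mult[OF 0]]) simp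
qed

lemma homog_flow: "homog (2 * n + 1) (flow \<omega> n)"
proof -
  have 0: "homog 1 (coord 0)" using homog.coord[of 0] by simp
  show ?thesis
    unfolding flow_def
    by (intro homog.add homog_mult'[OF homog_cst_mult[OF 0] homog_lenard_poly[OF homog_miura]]) (use homog_D[OF homog_lenard_poly[OF homog_miura]] in simp_all)
qed

text \<open>Here q = D v - v^2 / 2, and the right-hand side is (D - v) D (D + v) applied to
  k.\<close>

lemma lenard_op_factor:
  assumes "v = cst \<omega> * coord 0"
  shows "lenard_op (miura \<omega>) k = D (D (D k + v * k)) - v * D (D k + v * k)"
proof -
  have v1: "cst \<omega> * coord 1 = D v" by (simp add: assms vf.simps)
  have q: "miura \<omega> = D v - cst (1 / 2) * (v * v)"
    unfolding miura_def v1 by (simp add: assms)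
  have q2: "2 * miura \<omega> = 2 * D v - v * v"
    unfolding q by (simp add: right_diff_distrib half)
  have "D (miura \<omega>) = D (D v) - cst (1 / 2) * (2 * (v * D v))"
    unfolding q by (simp add: vf.simps algebra_simps)
  then have q': "D (miura \<omega>) = D (D v) - v * D v"
    by (simp only: half)
  show ?thesis
    unfolding lenard_op_def q2 q' by (simp add: vf.simps algebra_simps)
qed

text \<open>Let k, k' be the next Lenard polynomials for w, -w and B the present flow. The
  factorisation gives D k = (D - v) D B and, by induction, D k' = -(D + v) D B. The difference
  integrates to k - k' = 2 D B, and the sum is then -v (k - k'), which says (D + v) k = -(D - v)
  k'.\<close>

lemma flow_odd: "flow (- \<omega>) n = - flow \<omega> n"
proof (induction n)
  case 0
  show ?case by (simp add: flow_def vf.simps cst_simps)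
next
  case (Suc n)
  define v where "v = cst \<omega> * coord 0"
  have v': "cst (- \<omega>) * coord 0 = - v" by (simp add: v_def cst_simps)
  define B where "B = flow \<omega> n"
  define k where "k = lenard_poly (miura \<omega>) (Suc n)"
  define k' where "k' = lenard_poly (miura (- \<omega>)) (Suc n)"
  have "D k = D (D B) - v * D B"
    unfolding k_def lenard_recursion lenard_op_factor[OF v_def] by (simp add: B_def flow_def v_def)
  moreover have "D k' = D (D (- B)) - (- v) * D (- B)"
    unfolding k'_def lenard_recursion lenard_op_factor[OF v'[symmetric]] B_def Suc[symmetric]
    by (simp add: flow_def v')
  ultimately have sum: "D k + D k' = - (v * D B) - v * D B" and diff: "D (k - k' - 2 * D B) = 0"
    by (simp_all add: vf.simps vf.numeral)
  have "homog (Suc (2 * n + 1)) (D B)" unfolding B_def by (rule homog_D[OF homog_flow])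
  then have "homog (2 * Suc n) (cst 2 * D B)" by (simp add: homog_cst_mult)
  then have "homog (2 * Suc n) (k - k' - 2 * D B)"
    unfolding cst_2 k_def k'_def by (intro homog_diff homog_lenard_poly homog_miura)
  \<comment> \<open>The constant of integration is zero because k, k' and D B all have the positive
    weight 2 (n + 1).\<close>
  from homog_eq_0I[OF this _ diff] have "k - k' = 2 * D B" by simp
  then have "D k + D k' + v * (k - k') = 0" by (simp only: sum mult_2) (simp add: algebra_simps)
  moreover have A: "flow \<omega> (Suc n) = D k + v * k" "flow (- \<omega>) (Suc n) = D k' - v * k'"
    unfolding flow_def k_def k'_def v' by (simp_all add: v_def)
  have "flow (- \<omega>) (Suc n) = (D k + D k' + v * (k - k')) - flow \<omega> (Suc n)"
    unfolding A by (simp add: algebra_simps)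
  ultimately show ?case by simp
qed

text \<open>For a holomorphic polynomial free of z, both \<open>tD (cj x)\<close> and
  \<open>tD (cj (tD x))\<close> vanish, which leaves one half of each remaining condition.\<close>

lemma solves_homog:
  assumes x: "homog d x" and Dx: "vf (Ta \<beta>) (D x) = 0" "vf (Tb \<beta>) (D x) = x"
  shows "solves \<beta> x"
proof -
  note hx = homog_const[OF x] and hDx = homog_const[OF homog_D[OF x]]
  have "hol (du i x)" for i
    using hx(4) by (simp add: hol_def wd_commute[of \<i> _ _ "- \<i>"] wd.zero)
  moreover have "tD x = D x" by (simp add: tD_def hx)
  moreover have "tD (cj x) = 0" "tD (cj (D x)) = 0"
    by (simp_all add: tD_def dz_cj hx hDx vf_cj_hol)
  ultimately show ?thesis
    by (simp add: solves_def hx Dx vf.zero)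
qed

text \<open>\<open>Ta\<close> and \<open>Tb\<close> depend on w only through w^2. Adding and
  subtracting the characteristic equations for w and -w therefore separates the two fields, by
  oddness of the flow.\<close>

lemma solves_flow:
  assumes "\<omega> * \<omega> = \<beta>" "\<omega> \<noteq> 0"
  shows "solves \<beta> (flow \<omega> n)"
proof (rule solves_homog[OF homog_flow])
  let ?x = "D (flow \<omega> n)"
  have 1: "vf (Ta \<beta>) ?x + cst \<omega> * vf (Tb \<beta>) ?x = cst \<omega> * flow \<omega> n"
    using char_vf_flow[of \<omega> n] assms by (simp add: char_vf_eq)
  have 2: "vf (Ta \<beta>) ?x - cst \<omega> * vf (Tb \<beta>) ?x = - (cst \<omega> * flow \<omega> n)"
    using char_vf_flow[of "- \<omega>" n] assms by (simp add: char_vf_eq flow_odd vf.simps cst_simps flip: minus_diff_eq[of "cst _ * _"])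
  have "2 * vf (Ta \<beta>) ?x = 0" "2 * (cst \<omega> * (vf (Tb \<beta>) ?x - flow \<omega> n)) = 0"
    using arg_cong2[OF 1 2, of "(+)"] arg_cong2[OF 1 2, of "(-)"] by (simp_all add: algebra_simps)
  then show "vf (Ta \<beta>) ?x = 0" "vf (Tb \<beta>) ?x = flow \<omega> n"
    using assms(2) by (auto dest!: two_cancel simp: cst_cancel)
qed

text \<open>Up to order two only the terms with a factor K_0 = 1 survive in the recursion, so
  K_{n+1} agrees with D^2 K_n for n > 0; the start is K_1 = q with linear part w u_1.\<close>

lemma lenard_poly_Suc_linear: "vanish 2 (lenard_poly (miura \<omega>) (Suc n) - cst \<omega> * coord (2 * n + 1))"
proof (induction n rule: less_induct)
  case (less n)
  let ?K = "lenard_poly (miura \<omega>)"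
  have two: "(2::nat) = 1 + 1" by simp
  have v2: "vanish 2 (x * y)" if "ev0 x" "ev0 y" for x y
    unfolding two by (rule vanish_mult) (use that in simp_all)
  have D0: "ev0 (D x)" for x by (rule ev0_vf) simp
  have K0: "ev0 (?K i)" if "i > 0" for i
    using homog_ev0[OF homog_lenard_poly[OF homog_miura]] that by simp
  have q0: "ev0 (miura \<omega>)" by (rule homog_ev0[OF homog_miura]) simp
  show ?case
  proof (cases n)
    case 0
    have "lenard_poly (miura \<omega>) 1 = miura \<omega>"
      using lenard_poly.simps(2)[of "miura \<omega>" 0] by (simp add: vf.simps half)
    moreover have "vanish 2 (miura \<omega> - cst \<omega> * coord 1)"
    proof -
      have "vanish 2 (- (cst (1 / 2) * (cst \<omega> * coord 0 * (cst \<omega> * coord 0))))"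
        by (intro vanish_minus vanish_mult_left v2) simp_all
      then show ?thesis by (simp add: miura_def)
    qed
    ultimately show ?thesis using 0 by simp
  next
    case (Suc m)
    define g where "g i = 2 * ?K i * D (D (?K (n - i))) - D (?K i) * D (?K (n - i)) + 2 * miura \<omega> * ?K i * ?K (n - i)" for i
    have "{..n} = insert 0 {1..n}" by auto
    then have "(\<Sum>i\<le>n. g i) = g 0 + (\<Sum>i\<in>{1..n}. g i)" by simp
    moreover have "g 0 = 2 * D (D (?K n)) + 2 * (miura \<omega> * ?K n)"
      by (simp add: g_def vf.one mult.assoc)
    ultimately have "?K (Suc n) = cst (1 / 2) * (2 * D (D (?K n)) + 2 * (miura \<omega> * ?K n)
         + (\<Sum>i\<in>{1..n}. g i) - (\<Sum>i<n. ?K (Suc i) * ?K (n - i)))"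
      by (simp add: lenard_poly.simps(2)[of _ n] g_def mult.assoc)
    then have E: "?K (Suc n) - D (D (?K n)) = miura \<omega> * ?K n +
      cst (1 / 2) * ((\<Sum>i\<in>{1..n}. g i) - (\<Sum>i<n. ?K (Suc i) * ?K (n - i)))"
      by (simp add: half distrib_left right_diff_distrib)
    have "vanish 2 (g i)" if "i \<in> {1..n}" for i
    proof -
      have "vanish 2 (2 * (?K i * D (D (?K (n - i)))))" "vanish 2 (D (?K i) * D (?K (n - i)))"
         "vanish 2 (2 * (miura \<omega> * (?K i * ?K (n - i))))"
        using that by (intro vanish_mult_left v2 D0 K0 ev0_simps q0; simp)+
      then show ?thesis
        unfolding g_def mult.assoc by (intro vanish_add vanish_diff)
    qed
    then have 1: "vanish 2 (?K (Suc n) - D (D (?K n)))"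
      unfolding E using Suc
      by (intro vanish_add vanish_mult_left[of _ _ "cst (1 / 2)"] vanish_diff vanish_sum v2 K0 q0) auto
    have "vanish 2 (D (D (?K n - cst \<omega> * coord (2 * m + 1))))"
      using less[of m] Suc by (intro vanish_vf_1) auto
    then have 2: "vanish 2 (D (D (?K n)) - cst \<omega> * coord (2 * n + 1))"
      by (simp add: vf.simps Suc)
    show ?thesis using vanish_add[OF 1 2] by simp
  qed
qed

text \<open>The linear part shows that the flow is nonzero and fixes the scalar in the uniqueness
  proof.\<close>

lemma flow_linear: "vanish 2 (flow \<omega> n - cst \<omega> * coord (2 * n))"
proof (cases n)
  case 0
  then show ?thesis by (simp add: flow_def vf.one del: vanish.simps)
next
  case (Suc m)
  have "vanish 2 (D (lenard_poly (miura \<omega>) n - cst \<omega> * coord (2 * m + 1)))"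
    using lenard_poly_Suc_linear[of \<omega> m] Suc by (intro vanish_vf_1) auto
  then have 1: "vanish 2 (D (lenard_poly (miura \<omega>) n) - cst \<omega> * coord (2 * n))"
    by (simp add: vf.simps Suc)
  have "ev0 (lenard_poly (miura \<omega>) n)" using homog_ev0[OF homog_lenard_poly[OF homog_miura]] Suc by simp
  then have "vanish (1 + 1) (cst \<omega> * coord 0 * lenard_poly (miura \<omega>) n)"
    by (intro vanish_mult) simp_all
  then have 2: "vanish 2 (cst \<omega> * coord 0 * lenard_poly (miura \<omega>) n)" by (simp only: one_add_one)
  show ?thesis using vanish_add[OF 1 2] by (simp add: flow_def algebra_simps)
qed

section \<open>Uniqueness\<close>

text \<open>The linear part of b_i; \<open>vf lower\<close> is the operator S.\<close>

definition lower :: "nat \<Rightarrow> sjet" where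
  "lower i = (case i of 0 \<Rightarrow> 0 | Suc j \<Rightarrow> coord j)"

lemma lower_simps [simp]: "lower 0 = 0" "lower (Suc j) = coord j" "ev0 (lower i)"
  by (auto simp: lower_def split: nat.split)

lemma vanish_2_mult: "ev0 x \<Longrightarrow> ev0 y \<Longrightarrow> vanish 2 (x * y)"
  using vanish_mult[of 1 x 1 y] by (simp only: one_add_one) simp

lemma ev0_Tb: "ev0 (Tb \<beta> i)"
  by (cases i) (auto intro!: ev0_sum)

lemma vanish_Ta: "vanish 2 (Ta \<beta> (Suc i))"
  unfolding Ta.simps by (intro vanish_mult_left vanish_sum vanish_2_mult ev0_Tb) simp

lemma vanish_Tb: "vanish 2 (Tb \<beta> i - lower i)"
proof (cases i)
  case (Suc n)
  have "Tb \<beta> (Suc n) = coord n + (\<Sum>j\<in>{1..n}. of_nat (n choose j) * (coord (n - j) * Ta \<beta> j))"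
  proof -
    have "{..n} = insert 0 {1..n}" by auto
    then show ?thesis by simp
  qed
  moreover have "vanish 2 (Ta \<beta> j)" if "j \<in> {1..n}" for j
    using that vanish_Ta[of \<beta> "j - 1"] by simp
  ultimately show ?thesis
    using Suc by (auto intro!: vanish_sum vanish_mult_left simp del: vanish.simps Tb.simps simp: numeral_2_eq_2)
qed simp

lemma vf_Ta_split: "vf (Ta \<beta>) x = du 0 x + vf (\<lambda>i. if i = 0 then 0 else Ta \<beta> i) x"
proof -
  have "Ta \<beta> = (\<lambda>i. 1 * (if i = 0 then 1 else 0) + 1 * (if i = 0 then 0 else Ta \<beta> i))"
    by (auto simp: fun_eq_iff)
  then have "vf (Ta \<beta>) x = 1 * vf (\<lambda>i. if i = 0 then 1 else 0) x + 1 * vf (\<lambda>i. if i = 0 then 0 else Ta \<beta> i) x"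
    by (simp only: vf_lin[symmetric])
  then show ?thesis unfolding vf_delta by simp
qed

lemma vf_Tb_split: "vf (Tb \<beta>) x = vf lower x + vf (\<lambda>i. Tb \<beta> i - lower i) x"
  using vf_lin[of 1 lower 1 "\<lambda>i. Tb \<beta> i - lower i" x] by simp

text \<open>In the commutator of S and D the coefficient at i is u_i - D (\<open>lower i\<close>).
  It vanishes except at i = 0, where \<open>lower\<close> breaks off; hence the term with
  u_0.\<close>

lemma vf_lower_tD: "vf lower (tD x) = tD (vf lower x) + coord 0 * du 0 x"
proof -
  have 1: "vf (\<lambda>i. coord i) x = vf (\<lambda>i. D (lower i)) x + coord 0 * du 0 x"
  proof -
    have "(\<lambda>i. coord i) = (\<lambda>i. 1 * D (lower i) + coord 0 * (if i = 0 then 1 else 0))"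
    proof
      show "coord i = 1 * D (lower i) + coord 0 * (if i = 0 then 1 else 0)" for i
        by (cases i) (auto simp: vf.zero)
    qed
    then have "vf (\<lambda>i. coord i) x = vf (\<lambda>i. 1 * D (lower i) + coord 0 * (if i = 0 then 1 else 0)) x"
      by (rule arg_cong)
    also have "\<dots> = 1 * vf (\<lambda>i. D (lower i)) x + coord 0 * vf (\<lambda>i. if i = 0 then 1 else 0) x"
      by (rule vf_lin)
    finally show ?thesis unfolding vf_delta by simp
  qed
  have "dz (lower i) = 0" for i by (cases i) (auto simp: wd.zero wd_coord)
  then have 2: "dz (vf lower x) = vf lower (dz x)"
    by (simp add: vf_comm_derivation[OF derivation_wd wd_commute] vf_zero_coeff)
  show ?thesis
    using vf_commutator[of lower "\<lambda>i. coord (Suc i)" x] 1 by (simp add: tD_def vf.add 2)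
qed

lemma du_vf_lower: "du k (vf lower x) = vf lower (du k x) + du (Suc k) x"
proof -
  have "du k (lower i) = (if i = Suc k then 1 else 0)" for i
    by (cases i) (auto simp: wd.zero wd_coord)
  then show ?thesis by (simp add: du_vf vf_delta)
qed

section \<open>Raising the order of vanishing\<close>

lemma hol_wd: "hol x \<Longrightarrow> hol (wd k c c' x)"
  by (simp add: hol_def wd_commute[of \<i> "Re_u _"] wd.zero)

lemma hol_tD: "hol x \<Longrightarrow> hol (tD x)"
  unfolding tD_def using hol_vf[of "\<lambda>i. coord (Suc i)" x] hol_coord hol_wd[of x]
  by (simp add: hol_def wd.simps)

lemma hol_du_tD:
  assumes "\<And>i. hol (du i x)"
  shows "hol (du i (tD x))"
proof (cases i)
  case 0
  then show ?thesis using assms by (simp add: du_tD hol_tD)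
next
  case (Suc j)
  then show ?thesis using assms hol_tD[OF assms] by (simp add: du_tD hol_def wd.simps)
qed

text \<open>A derivative d/du_k kills the conjugated half of each condition, as mixed derivatives
  vanish; the two halves of a solution thereby decouple.\<close>

lemma solves_du:
  assumes "solves \<beta> x"
  shows "du k (vf (Ta \<beta>) (tD x)) = 0" "du k (vf (Tb \<beta>) (tD x)) = du k x"
proof -
  have m: "\<And>i. hol (du i x)" using assms by (simp add: solves_def)
  have h: "du k (cj (vf c (tD (cj x)))) = 0" if "\<And>i. hol (c i)" for c
  proof -
    have "hol (vf c (tD (cj x)))"
      by (intro hol_vf that hol_du_tD hol_du_cj m)
    then show ?thesis by (simp add: du_cj hol_def)
  qed
  have 1: "vf (Ta \<beta>) (tD x) + cj (vf (Ta \<beta>) (tD (cj x))) = 0"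
    and 2: "vf (Tb \<beta>) (tD x) + cj (vf (Tb \<beta>) (tD (cj x))) = x"
    using solves_cj[OF assms] by (simp_all add: solves_def)
  show "du k (vf (Ta \<beta>) (tD x)) = 0"
    using arg_cong[OF 1, of "du k"] h[OF hol_Tab(1)] by (simp add: wd.simps)
  show "du k (vf (Tb \<beta>) (tD x)) = du k x"
    using arg_cong[OF 2, of "du k"] h[OF hol_Tab(2)] by (simp add: wd.simps)
qed

lemma vanish_du: "vanish (Suc k) x \<Longrightarrow> vanish k (du i x)"
  by simp

text \<open>Beyond their leading parts d/du_0 and S, the fields have coefficients of order two. The
  remainder thus has order l + 2, and after d/du_k still order l + 1, one better than what is known
  of d/du_k x.\<close>

lemma solves_leading:
  assumes x: "solves \<beta> x" and v: "vanish (Suc l) x"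
  shows "vanish (Suc l) (du k (tD (du 0 x)))" "vanish (Suc l) (du k (vf lower (tD x)) - du k x)"
proof -
  have w: "vanish l (du i (tD x))" for i
    using vanish_tD[OF v] by (rule vanish_du)
  have "vanish (2 + l) (vf (\<lambda>i. if i = 0 then 0 else Ta \<beta> i) (tD x))"
  proof (rule vanish_vf[OF _ w])
    show "vanish 2 (if i = 0 then 0 else Ta \<beta> i)" for i
      using vanish_Ta[of \<beta> "i - 1"] by (cases i) (auto simp del: vanish.simps Ta.simps)
  qed
  then have "vanish (Suc l) (du k (vf (\<lambda>i. if i = 0 then 0 else Ta \<beta> i) (tD x)))"
    by (intro vanish_du) (simp only: add_2_eq_Suc)
  moreover have "du k (tD (du 0 x)) = - du k (vf (\<lambda>i. if i = 0 then 0 else Ta \<beta> i) (tD x))"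
    using solves_du(1)[OF x, of k] by (simp add: vf_Ta_split wd.simps du_tD add_eq_0_iff2)
  ultimately show "vanish (Suc l) (du k (tD (du 0 x)))" by (simp only: vanish_minus)
  have "vanish (2 + l) (vf (\<lambda>i. Tb \<beta> i - lower i) (tD x))"
    by (rule vanish_vf[OF vanish_Tb w])
  then have "vanish (Suc l) (du k (vf (\<lambda>i. Tb \<beta> i - lower i) (tD x)))"
    by (intro vanish_du) (simp only: add_2_eq_Suc)
  moreover have "du k (vf lower (tD x)) - du k x = - du k (vf (\<lambda>i. Tb \<beta> i - lower i) (tD x))"
    using solves_du(2)[OF x, of k] by (simp add: vf_Tb_split wd.simps algebra_simps)
  ultimately show "vanish (Suc l) (du k (vf lower (tD x)) - du k x)" by (simp only: vanish_minus)
qed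

lemma vanish_vf_lower: "vanish m x \<Longrightarrow> vanish m (vf lower x)"
  by (rule vanish_vf_1) simp_all

lemma vanish_cancel: "vanish m (x + y) \<Longrightarrow> vanish m x \<Longrightarrow> vanish m y"
  using vanish_diff[of m "x + y" x] by simp

text \<open>Order of vanishing replaces homogeneous parts. The first condition improves d/du_0 x. In
  d/du_k of tD S x - x, the only term with a derivative of x of index above k is tD (d/du_{k+1} x),
  the term d/du_k x cancels, and \<open>tD_inj\<close> removes tD; so the improvement climbs in
  k.\<close>

lemma vanish_step:
  assumes x: "solves \<beta> x" and v: "vanish (Suc (Suc l)) x"
  shows "vanish (Suc (Suc (Suc l))) x"
proof -
  let ?m = "Suc (Suc l)"
  \<comment> \<open>\<open>tD_inj\<close> controls only derivatives of d/du_k x, not its value at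
    u_i = 0. That value is the linear part of x, which must therefore vanish beforehand.\<close>
  have e: "ev0 (du k x)" for k using v by simp
  have inj: "vanish ?m (du k x)" if "vanish ?m (tD (du k x))" for k
  proof -
    have "vanish (Suc l) (du i (du k x))" for i
      by (rule tD_inj) (rule vanish_du[OF that])
    then show ?thesis using e by (subst vanish.simps) simp
  qed
  have "vanish ?m (du i (du 0 x))" for i
    by (rule tD_inj) (rule solves_leading(1)[OF x v])
  then have "vanish (Suc ?m) (du 0 x)" using e by (subst vanish.simps) simp
  then have z: "vanish ?m (du 0 x)" by (rule vanish_Suc_D)
  have "vanish (Suc ?m) (coord 0 * du 0 x)"
    using vanish_mult[of 1 "coord 0" ?m, OF _ z] by (simp del: vanish.simps add: vanish_1[unfolded One_nat_def[symmetric]])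
  then have "vanish ?m (du k (coord 0 * du 0 x))" for k by (rule vanish_du)
  with solves_leading(2)[OF x v]
  have c: "vanish ?m (du k (tD (vf lower x)) - du k x)" for k
    using vanish_diff[of ?m "du k (vf lower (tD x)) - du k x" "du k (coord 0 * du 0 x)"]
    by (simp only: vf_lower_tD wd.add) (simp add: algebra_simps del: vanish.simps)
  have "\<forall>j\<le>k. vanish ?m (du j x)" for k
  proof (induction k)
    case (Suc k)
    have "vanish ?m (tD (du (Suc k) x))"
    proof (cases k)
      case 0
      have E: "du 0 (tD (vf lower x)) - du 0 x = (tD (vf lower (du 0 x)) - du 0 x) + tD (du (Suc 0) x)"
        by (simp add: du_tD du_vf_lower tD.simps)
      have "vanish ?m (tD (vf lower (du 0 x)) - du 0 x)"
        by (rule vanish_diff[OF vanish_tD[OF vanish_vf_lower[OF z]] z])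
      then show ?thesis
        unfolding 0 by (rule vanish_cancel[OF c[of 0, unfolded E]])
    next
      case (Suc j)
      have E: "du k (tD (vf lower x)) - du k x = (tD (vf lower (du k x)) + vf lower (du j x)) + tD (du (Suc k) x)"
        unfolding Suc by (simp add: du_tD du_vf_lower tD.simps algebra_simps)
      have "vanish ?m (tD (vf lower (du k x)) + vf lower (du j x))"
        using Suc.IH Suc by (intro vanish_add vanish_tD vanish_vf_lower) (auto simp del: vanish.simps)
      then show ?thesis
        by (rule vanish_cancel[OF c[of k, unfolded E]])
    qed
    then have "vanish ?m (du (Suc k) x)" by (rule inj)
    then show ?case using Suc.IH by (auto simp: le_Suc_eq simp del: vanish.simps)
  qed (use z in \<open>simp del: vanish.simps\<close>)
  then have "vanish ?m (du k x)" for k by blast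
  then show ?thesis
    using v by (subst vanish.simps) simp
qed

lemma vanish_all:
  assumes x: "solves \<beta> x" and v: "vanish 2 x"
  shows "vanish m x"
proof -
  have "vanish (Suc (Suc l)) x" for l
    by (induction l) (use v vanish_step[OF x] in \<open>simp_all add: numeral_2_eq_2 del: vanish.simps\<close>)
  then show ?thesis using vanish_mono[of "Suc (Suc m)" x m] by simp
qed

section \<open>The linear part of a solution\<close>

lemma solves_ev0:
  assumes "solves \<beta> x"
  shows "ev0 x"
proof -
  have "vf (Tb \<beta>) (tD x) + cj (vf (Tb \<beta>) (tD (cj x))) = x"
    using solves_cj[OF assms] by (simp add: solves_def)
  moreover have "ev0 (vf (Tb \<beta>) (tD x) + cj (vf (Tb \<beta>) (tD (cj x))))"
    by (simp add: ev0_vf ev0_Tb)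
  ultimately show ?thesis by simp
qed

lemma ev0_tD: "ev0 (tD x) \<longleftrightarrow> ev0 (dz x)"
  using ev0_vf[of "\<lambda>i. coord (Suc i)" x] by (auto simp: tD_def ev0_def)

lemma ev0_cancel: "ev0 (x + y) \<Longrightarrow> ev0 x \<Longrightarrow> ev0 y"
  by (simp add: ev0_def)

text \<open>Moving d/du_k past S in S tD x - x produces d/du_{k+1} tD x, whose extra term d/du_k x
  cancels. At u_i = 0 only tD (d/du_{k+1} x) remains, where tD reduces to d/dz.\<close>

lemma solves_dz:
  assumes "solves \<beta> x"
  shows "ev0 (dz (du (Suc k) x))"
proof -
  have "ev0 (du k (vf lower (tD x)) - du k x)"
    using solves_leading(2)[OF assms, of 0 k] solves_ev0[OF assms] by simp
  moreover have "du k (vf lower (tD x)) - du k x = vf lower (du k (tD x)) + tD (du (Suc k) x)"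
    by (simp add: du_vf_lower du_tD)
  moreover have "ev0 (vf lower (du k (tD x)))" by (simp add: ev0_vf)
  ultimately have "ev0 (tD (du (Suc k) x))" using ev0_cancel by metis
  then show ?thesis by (simp add: ev0_tD)
qed

text \<open>Apply d/du_{k+1} to the conjugate of the coefficient of 1: the conjugated summand is
  killed, and commuting with tD releases d/du_k x, while the other term vanishes at u_i = 0 by
  \<open>solves_dz\<close>.\<close>

lemma solves_dzb:
  assumes "solves \<beta> x"
  shows "ev0 (dzb (du k x))"
proof -
  have m: "\<And>i. hol (du i x)" using assms by (simp add: solves_def)
  have "cj (tD (cj (tD x))) = 0" using assms by (simp add: solves_def)
  then have "dzb (tD x) + cj (D (cj (tD x))) = 0"
    by (simp add: tD_def[of "cj _"] dz_cj)
  then have "du (Suc k) (dzb (tD x)) + du (Suc k) (cj (D (cj (tD x)))) = 0"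
    by (metis wd.add wd.zero)
  moreover have "hol (D (cj (tD x)))"
    by (intro hol_vf hol_coord hol_du_cj hol_du_tD m)
  then have "du (Suc k) (cj (D (cj (tD x)))) = 0" by (simp add: du_cj hol_def)
  ultimately have "dzb (tD (du (Suc k) x)) + dzb (du k x) = 0"
    by (simp add: wd_commute[of _ _ _ \<i>] du_tD flip: wd.add)
  moreover have "ev0 (dzb (tD (du (Suc k) x)))"
    by (intro ev0_wd) (simp add: ev0_tD solves_dz[OF assms])
  ultimately show ?thesis
    by (metis ev0_cancel ev0_simps(1))
qed

text \<open>At u_i = 0 the coefficient of f couples d/dz d/du_0 of x with the conjugate of the same
  expression in \<open>cj x\<close>. A further d/dz removes the latter by
  \<open>solves_dzb\<close>.\<close>

lemma solves_dz_dz: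
  assumes "solves \<beta> x"
  shows "ev0 (dz (dz (du 0 x)))"
proof -
  let ?a = "\<lambda>i. if i = 0 then 0 else Ta \<beta> i"
  have a: "ev0 (?a i)" for i
    using vanish_mono[OF vanish_Ta[of \<beta> "i - 1"], of 1] by (cases i) auto
  have "vf (Ta \<beta>) (tD x) + cj (vf (Ta \<beta>) (tD (cj x))) = 0"
    using solves_cj[OF assms] by (simp add: solves_def)
  then have "(vf ?a (tD x) + cj (vf ?a (tD (cj x)))) + (tD (du 0 x) + cj (tD (du 0 (cj x)))) = 0"
    by (simp add: vf_Ta_split du_tD algebra_simps)
  moreover have "ev0 (vf ?a (tD x) + cj (vf ?a (tD (cj x))))"
    using ev0_vf[of ?a, OF a] by simp
  ultimately have "ev0 (tD (du 0 x) + cj (tD (du 0 (cj x))))"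
    by (metis ev0_cancel ev0_simps(1))
  moreover have "tD (du 0 x) + cj (tD (du 0 (cj x))) =
      (D (du 0 x) + cj (D (du 0 (cj x)))) + (dz (du 0 x) + cj (dz (du 0 (cj x))))"
    by (simp add: tD_def)
  moreover have "ev0 (D (du 0 x) + cj (D (du 0 (cj x))))"
    by (simp add: ev0_vf)
  ultimately have "ev0 (cj (dz (du 0 (cj x))) + dz (du 0 x))"
    using ev0_cancel by (metis add.commute)
  then have "ev0 (dz (cj (dz (du 0 (cj x)))) + dz (dz (du 0 x)))"
    unfolding wd.add[symmetric] by (rule ev0_wd)
  moreover have "ev0 (dz (cj (dz (du 0 (cj x)))))"
  proof -
    have "dz (cj (dz y)) = cj (dz (dzb y))" for y
      unfolding dz_cj by (subst wd_commute) (rule refl)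
    then show ?thesis
      using ev0_wd[OF solves_dzb[OF solves_cj[OF assms], of 0], of "- \<i>"] by simp
  qed
  ultimately show ?thesis by (rule ev0_cancel)
qed

section \<open>Dependence on z and the weight\<close>

lemma has_vector_derivative_const_imp:
  fixes h :: "real \<Rightarrow> complex"
  assumes "\<And>t. (h has_vector_derivative a) (at t)"
  shows "h t = h 0 + of_real t * a"
proof -
  have "((\<lambda>t. h t - of_real t * a) has_vector_derivative a - 1 * a) (at t within UNIV)" for t
    unfolding has_vector_derivative_def
    using assms[of t, unfolded has_vector_derivative_def]
    by (auto intro!: derivative_eq_intros simp: scaleR_conv_of_real algebra_simps)
  then have "((\<lambda>t. h t - of_real t * a) has_derivative (\<lambda>_. 0)) (at t within UNIV)" for t
    by (simp add: has_vector_derivative_def)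
  then have "h t - of_real t * a = h 0 - of_real 0 * a"
    by (rule has_derivative_zero_unique[OF convex_UNIV]) auto
  then show ?thesis by (simp add: algebra_simps)
qed

lemma val_affine:
  assumes "\<And>z u. val (dc Re_z g) (z, u, \<lambda>_. 0) = a" "\<And>z u. val (dc Im_z g) (z, u, \<lambda>_. 0) = b"
    "\<And>z u. val (dc U g) (z, u, \<lambda>_. 0) = 0"
  shows "val g (z, u, \<lambda>_. 0) = val g (0, 0, \<lambda>_. 0) + of_real (Re z) * a + of_real (Im z) * b"
proof -
  note d = pdiff_has_derivative[OF smooth_jetD(3)[OF smooth_val], of g, folded val_dc]
  have "((\<lambda>t. val g (translate Re_z t (w, v, \<lambda>_. 0))) has_vector_derivative a) (at t)" for w v t
    using d[of Re_z "(w, v, \<lambda>_. 0)" t] assms(1) by simp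
  from has_vector_derivative_const_imp[OF this]
  have 1: "val g (w + of_real t, v, \<lambda>_. 0) = val g (w, v, \<lambda>_. 0) + of_real t * a" for w v t by simp
  have "((\<lambda>t. val g (translate Im_z t (w, v, \<lambda>_. 0))) has_vector_derivative b) (at t)" for w v t
    using d[of Im_z "(w, v, \<lambda>_. 0)" t] assms(2) by simp
  from has_vector_derivative_const_imp[OF this]
  have 2: "val g (w + \<i> * of_real t, v, \<lambda>_. 0) = val g (w, v, \<lambda>_. 0) + of_real t * b" for w v t by simp
  have "((\<lambda>t. val g (translate U t (w, v, \<lambda>_. 0))) has_vector_derivative 0) (at t)" for w v t
    using d[of U "(w, v, \<lambda>_. 0)" t] assms(3) by simp
  from has_vector_derivative_const_imp[OF this]
  have 3: "val g (w, v + t, \<lambda>_. 0) = val g (w, v, \<lambda>_. 0)" for w v t by simp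
  have "z = 0 + of_real (Re z) + \<i> * of_real (Im z)" by (simp add: complex_eq_iff)
  then have "val g (z, u, \<lambda>_. 0) = val g (0 + of_real (Re z) + \<i> * of_real (Im z), 0 + u, \<lambda>_. 0)"
    by simp
  also have "\<dots> = val g (0, 0, \<lambda>_. 0) + of_real (Re z) * a + of_real (Im z) * b"
    by (simp only: 1 2 3)
  finally show ?thesis .
qed

lemma dc_z_eq: "dc Re_z g = dz g + dzb g" "dc Im_z g = cst \<i> * (dz g - dzb g)"
  by (rule sjet_eqI; simp add: wd_def field_simps)+

text \<open>The weight condition is differentiated in u_k at the origin of the jet variables. Since
  x is only real differentiable there, the chain rule is applied to the real derivative and its
  complex-linear part is extracted afterwards.\<close>

lemma weighted_degree_du:
  assumes w: "weighted_degree d (val x)" and l: "cmod l = 1"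
  shows "l ^ (k + 1) * val (du k x) (inverse l * z, u, \<lambda>_. 0) = l powi d * val (du k x) (z, u, \<lambda>_. 0)"
proof -
  let ?a = "\<lambda>z. val (dc (Re_u k) x) (z, u, \<lambda>_. 0)" and ?b = "\<lambda>z. val (dc (Im_u k) x) (z, u, \<lambda>_. 0)"
  let ?L = "\<lambda>z h. of_real (Re h) * ?a z + of_real (Im h) * ?b z"
  let ?W = "l ^ (k + 1)"
  have z0: "(\<lambda>_. 0)(k := 0) = (\<lambda>_. 0 :: complex)" by auto
  have d: "((\<lambda>\<zeta>. val x (z, u, (\<lambda>_. 0)(k := \<zeta>))) has_derivative ?L z) (at 0)" for z
    using has_derivative_coord[OF smooth_val, of x z u "\<lambda>_. 0" k 0] by (simp add: z0 val_dc)
  have "((\<lambda>\<zeta>. ?W * \<zeta>) has_derivative (\<lambda>h. ?W * h)) (at 0)"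
    by (intro has_derivative_mult_right has_derivative_ident)
  moreover have "((\<lambda>\<zeta>. val x (inverse l * z, u, (\<lambda>_. 0)(k := \<zeta>))) has_derivative ?L (inverse l * z)) (at (?W * 0))"
    using d[of "inverse l * z"] by (simp only: mult_zero_right)
  ultimately have "((\<lambda>\<zeta>. val x (inverse l * z, u, (\<lambda>_. 0)(k := ?W * \<zeta>))) has_derivative
      (\<lambda>h. ?L (inverse l * z) (?W * h))) (at 0)"
    by (rule has_derivative_compose)
  moreover have "val x (inverse l * z, u, (\<lambda>_. 0)(k := ?W * \<zeta>)) = l powi d * val x (z, u, (\<lambda>_. 0)(k := \<zeta>))" for \<zeta>
  proof -
    have "(\<lambda>_. 0)(k := ?W * \<zeta>) = (\<lambda>j. l ^ (j + 1) * ((\<lambda>_. 0)(k := \<zeta>)) j)"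
      by (auto simp: fun_eq_iff)
    then show ?thesis using w l unfolding weighted_degree_def by metis
  qed
  ultimately have d1: "((\<lambda>\<zeta>. l powi d * val x (z, u, (\<lambda>_. 0)(k := \<zeta>))) has_derivative
      (\<lambda>h. ?L (inverse l * z) (?W * h))) (at 0)" by simp
  have d2: "((\<lambda>\<zeta>. l powi d * val x (z, u, (\<lambda>_. 0)(k := \<zeta>))) has_derivative
      (\<lambda>h. l powi d * ?L z h)) (at 0)"
    by (intro has_derivative_mult_right d)
  have L: "?L (inverse l * z) (?W * h) = l powi d * ?L z h" for h
    by (rule fun_cong[OF has_derivative_unique[OF d1 d2]])
  \<comment> \<open>For a real-linear L with L 1 = a and L \<i> = b this is L w - \<i> L (w \<i>):
    twice the complex-linear part of L, evaluated at w.\<close>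
  have *: "of_real (Re w) * a + of_real (Im w) * b - \<i> * (of_real (Re (w * \<i>)) * a + of_real (Im (w * \<i>)) * b)
      = w * (a - \<i> * b)" for w a b
  proof -
    have "(of_real (Re w) + \<i> * of_real (Im w)) * (a - \<i> * b) =
        of_real (Re w) * a + of_real (Im w) * b - \<i> * (of_real (Re (w * \<i>)) * a + of_real (Im (w * \<i>)) * b)"
      by (simp add: algebra_simps)
    then show ?thesis by (simp flip: complex_eq)
  qed
  have "?W * (?a (inverse l * z) - \<i> * ?b (inverse l * z)) =
      ?L (inverse l * z) (?W * 1) - \<i> * ?L (inverse l * z) (?W * \<i>)"
    by (simp only: mult_1_right *)
  also have "\<dots> = l powi d * ?L z 1 - \<i> * (l powi d * ?L z \<i>)" by (simp only: L)
  also have "\<dots> = l powi d * (?a z - \<i> * ?b z)" by (simp add: algebra_simps)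
  finally have "?W * (?a (inverse l * z) - \<i> * ?b (inverse l * z)) = l powi d * (?a z - \<i> * ?b z)" .
  moreover have "val (du k x) (w, u, \<lambda>_. 0) = (1 / 2) * (?a w - \<i> * ?b w)" for w
    by (simp add: wd_def)
  ultimately show ?thesis by (simp only: mult.left_commute[of _ "1 / 2"])
qed

lemma powi_ne_1:
  assumes "n \<noteq> 0"
  obtains l where "cmod l = 1" "l powi n \<noteq> 1"
proof
  show "cmod (cis (pi / of_int n)) = 1" by simp
  have "cis (pi / of_int n) powi n = cis (of_int n * (pi / of_int n))"
    by (rule cis_power_int)
  \<comment> \<open>The power is cis pi = -1.\<close>
  then show "cis (pi / of_int n) powi n \<noteq> 1" using assms by simp
qed

lemma weight_eq_0:
  assumes "\<And>l. cmod l = 1 \<Longrightarrow> l ^ m * c = l powi d * c" "int m \<noteq> d"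
  shows "c = (0 :: complex)"
proof (rule ccontr)
  assume "c \<noteq> 0"
  obtain l where l: "cmod l = 1" "l powi (d - int m) \<noteq> 1"
    using powi_ne_1[of "d - int m"] assms(2) by auto
  then have "l \<noteq> 0" by auto
  moreover have "l ^ m = l powi d" using assms(1)[OF l(1)] \<open>c \<noteq> 0\<close> by simp
  ultimately show False using l(2) by (simp add: power_int_diff)
qed

text \<open>At u_i = 0 all coefficients are constant except that of u_0, which is a_0 + z e. The
  weight forces e = 0 because d is nonzero, and leaves at most one constant.\<close>

lemma solves_linear:
  assumes x: "solves \<beta> x" and w: "weighted_degree d (val x)" and d: "d \<noteq> 0"
  obtains c where "\<And>k z u. val (du k x) (z, u, \<lambda>_. 0) = (if int (k + 1) = d then c else 0)"
proof -
  have Ux: "dU x = 0" using x by (simp add: solves_def)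
  have U: "dU (wd k c c' x) = 0" for k c c'
    by (simp only: wd_dc_commute[symmetric] Ux wd.zero)
  have dzb: "val (dzb (du k x)) (z, u, \<lambda>_. 0) = 0" for k z u
    using solves_dzb[OF x] by (simp add: ev0_def)
  have dz: "val (dz (du (Suc k) x)) (z, u, \<lambda>_. 0) = 0" for k z u
    using solves_dz[OF x] by (simp add: ev0_def)
  define e where "e = val (dz (du 0 x)) (0, 0, \<lambda>_. 0)"
  have dz0: "val (dz (du 0 x)) (z, u, \<lambda>_. 0) = e" for z u
  proof -
    have "ev0 (dzb (dz (du 0 x)))"
      using ev0_wd[OF solves_dzb[OF x, of 0], of "- \<i>"] by (subst wd_commute)
    then have "val (dzb (dz (du 0 x))) (z, u, \<lambda>_. 0) = 0" "val (dz (dz (du 0 x))) (z, u, \<lambda>_. 0) = 0" for z u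
      using solves_dz_dz[OF x] by (simp_all add: ev0_def)
    moreover have "dU (dz (du 0 x)) = 0" by (simp only: wd_dc_commute[symmetric] Ux wd.zero)
    ultimately show ?thesis
      using val_affine[of "dz (du 0 x)" 0 0 z u] by (simp add: dc_z_eq e_def)
  qed
  define a where "a k = val (du k x) (0, 0, \<lambda>_. 0)" for k
  have S: "val (du (Suc k) x) (z, u, \<lambda>_. 0) = a (Suc k)" for k z u
    using val_affine[of "du (Suc k) x" 0 0 z u] by (simp add: dc_z_eq dz dzb U a_def)
  have Z: "val (du 0 x) (z, u, \<lambda>_. 0) = a 0 + z * e" for z u
  proof -
    have "val (du 0 x) (z, u, \<lambda>_. 0) = a 0 + of_real (Re z) * e + of_real (Im z) * (\<i> * e)"
      unfolding a_def by (rule val_affine) (simp_all add: dc_z_eq dz0 dzb U)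
    also have "\<dots> = a 0 + (of_real (Re z) + \<i> * of_real (Im z)) * e" by (simp add: algebra_simps)
    finally show ?thesis by (simp flip: complex_eq)
  qed
  note W = weighted_degree_du[OF w]
  have W0: "l * a 0 = l powi d * a 0" if "cmod l = 1" for l
    using W[OF that, of 0 0 0] unfolding Z by simp
  \<comment> \<open>At z = 1 the weight relation reads l a_0 + e = l^d (a_0 + e); subtract the
    relation at z = 0.\<close>
  have "l ^ 0 * e = l powi d * e" if "cmod l = 1" for l
  proof -
    have "l \<noteq> 0" using that by auto
    then show ?thesis
      using W[OF that, of 0 1 0] W0[OF that] unfolding Z by (simp add: distrib_left)
  qed
  then have e0: "e = 0" by (rule weight_eq_0) (use d in auto)
  have all: "val (du k x) (z, u, \<lambda>_. 0) = a k" for k z u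
    by (cases k) (simp_all add: S Z e0)
  have "a k = 0" if "int (k + 1) \<noteq> d" for k
  proof (rule weight_eq_0[OF _ that])
    show "l ^ (k + 1) * a k = l powi d * a k" if "cmod l = 1" for l
      using W[OF that, of k 0 0] unfolding all .
  qed
  then have "val (du k x) (z, u, \<lambda>_. 0) = (if int (k + 1) = d then a (nat (d - 1)) else 0)" for k z u
    unfolding all by auto
  then show thesis by (rule that)
qed

text \<open>The identity theorem, one variable at a time. In the last possibly nonzero variable g is
  entire; its derivatives at 0 are values of iterated \<open>du n\<close> of g at points with one
  variable fewer, so the induction must range over all g.\<close>

lemma hol_eq_0_supp:
  assumes "hol g" "\<And>m. vanish m g" "\<And>i. i \<ge> n \<Longrightarrow> p i = 0"
  shows "val g (z, u, p) = 0"
  using assms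
proof (induction n arbitrary: g p)
  case 0
  then have "p = (\<lambda>_. 0)" by auto
  then show ?case using "0.prems"(2)[of 1] by (simp add: ev0_def)
next
  case (Suc n)
  define h where "h y \<zeta> = val y (z, u, p(n := \<zeta>))" for y \<zeta>
  have d: "(h y has_field_derivative h (du n y) \<zeta>) (at \<zeta>)" if "hol y" for y \<zeta>
  proof -
    have "dub n y = 0" using that by (simp add: hol_def)
    then have e: "cst (1 / 2) * (dc (Re_u n) y + cst \<i> * dc (Im_u n) y) = 0" by (simp add: wd_def)
    have i: "val (dc (Re_u n) y) v = - \<i> * val (dc (Im_u n) y) v" for v
      using arg_cong[OF e, of "\<lambda>x. val x v"] by (simp add: add_eq_0_iff2)
    have "val (du n y) v = - \<i> * val (dc (Im_u n) y) v" for v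
      by (simp add: wd_def i)
    moreover have "(h y has_derivative (\<lambda>k. of_real (Re k) * val (dc (Re_u n) y) (z, u, p(n := \<zeta>))
         + of_real (Im k) * val (dc (Im_u n) y) (z, u, p(n := \<zeta>)))) (at \<zeta>)"
      unfolding h_def val_dc by (rule has_derivative_coord) simp
    moreover have "of_real (Re k) * (- \<i> * c) + of_real (Im k) * c = - \<i> * c * k" for k c
    proof -
      have "- \<i> * c * (of_real (Re k) + \<i> * of_real (Im k)) = of_real (Re k) * (- \<i> * c) + of_real (Im k) * c"
        by (simp add: algebra_simps)
      then show ?thesis by (simp flip: complex_eq)
    qed
    then have "(\<lambda>k. of_real (Re k) * (- \<i> * c) + of_real (Im k) * c) = (*) (- \<i> * c)" for c
      by (rule ext)
    ultimately show ?thesis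
      unfolding has_field_derivative_def h_def i by simp
  qed
  define G where "G m = (du n ^^ m) g" for m
  have G: "hol (G m) \<and> (\<forall>k. vanish k (G m))" for m
  proof (induction m)
    case (Suc m)
    then show ?case using vanish_du by (auto simp: G_def hol_wd simp del: vanish.simps)
  qed (use Suc.prems in \<open>simp add: G_def\<close>)
  have D: "(deriv ^^ m) (h g) = h (G m)" for m
  proof (induction m)
    case (Suc m)
    have "deriv (h (G m)) = h (G (Suc m))"
      using d[of "G m"] G by (auto simp: fun_eq_iff G_def intro!: DERIV_imp_deriv)
    then show ?case using Suc by simp
  qed (simp add: G_def)
  have "h g holomorphic_on UNIV"
    using d[OF Suc.prems(1)] by (auto simp: holomorphic_on_open)
  moreover have "(deriv ^^ m) (h g) 0 = 0" for m
    unfolding D h_def using G Suc.prems(3) by (intro Suc.IH) (auto simp: le_Suc_eq)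
  ultimately have "h g (p n) = 0"
    using holomorphic_fun_eq_0_on_ball[of "h g" 0 "norm (p n) + 1" "p n"]
    by (auto intro: holomorphic_on_subset)
  then show ?case by (simp add: h_def)
qed

lemma hol_eq_0:
  assumes "hol g" "\<And>m. vanish m g"
  shows "g = 0"
proof (rule sjet_eqI)
  fix z u p
  obtain n where n: "\<And>z u p q. (\<forall>i<n. p i = q i) \<Longrightarrow> val g (z, u, p) = val g (z, u, q)"
    using smooth_jetD(1)[OF smooth_val[of g]] unfolding finitely_many_coords_def by metis
  have "val g (z, u, p) = val g (z, u, \<lambda>i. if i < n then p i else 0)" by (rule n) simp
  also have "\<dots> = 0" by (rule hol_eq_0_supp[OF assms, of n]) auto
  finally show "val g (z, u, p) = val 0 (z, u, p)" by simp
qed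

text \<open>A solution is not holomorphic, but its derivatives d/du_k, and those of its conjugate,
  are; the identity theorem applies to these and leaves a function of z and u that is zero at u_i =
  0.\<close>

lemma solves_eq_0:
  assumes x: "solves \<beta> x" and v: "vanish 2 x" "vanish 2 (cj x)"
  shows "x = 0"
proof (rule sjet_eqI)
  fix z u p
  have "du k y = 0" if y: "solves \<beta> y" "vanish 2 y" for y k
  proof (rule hol_eq_0)
    show "hol (du k y)" using y(1) by (simp add: solves_def)
    show "vanish m (du k y)" for m using vanish_all[OF y, of "Suc m"] by simp
  qed
  from this[OF x v(1)] this[OF solves_cj[OF x] v(2)] have "du k x = 0" "dub k x = 0" for k
    by (simp_all add: du_cj)
  then have "val x (z, u, p) = val x (z, u, \<lambda>_. 0)" by (rule val_eq_at_0)
  then show "val x (z, u, p) = val 0 (z, u, p)" using v(1) by (simp add: numeral_2_eq_2 ev0_def)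
qed

section \<open>Dimension one\<close>

lemma solves_lincomb:
  assumes "solves \<beta> x" "solves \<beta> y"
  shows "solves \<beta> (x - cst c * y)"
proof -
  have h: "hol (a - cst c * b)" if "hol a" "hol b" for a b c
    using that by (simp add: hol_def wd.simps)
  have A: "a - cst c * b + (a' - cst c * b') = (a + a') - cst c * (b + b')" for a a' b b' c
    by (simp add: algebra_simps)
  show ?thesis
    using assms
    by (simp add: solves_def dc.simps wd.simps tD.simps vf.simps h A)
qed

lemma weighted_homog:
  assumes "homog n x"
  shows "weighted_degree (int n) (val x)"
  unfolding weighted_degree_def using homog_weight[OF assms] by simp

lemma weighted_cj:
  assumes "weighted_degree d (val x)"
  shows "weighted_degree (- d) (val (cj x))"
  unfolding weighted_degree_def
proof (intro allI impI)
  fix z u p and l :: complex assume l: "cmod l = 1"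
  then have "cnj (l powi d) = l powi (- d)"
  proof -
    have "l * cnj l = 1" using l by (simp add: complex_norm_square[symmetric])
    moreover have "l \<noteq> 0" using l by auto
    ultimately have "cnj l = inverse l" by (simp add: field_simps)
    then show ?thesis by (simp add: power_int_inverse power_int_minus)
  qed
  then show "val (cj x) (inverse l * z, u, \<lambda>j. l ^ (j + 1) * p j) = l powi (- d) * val (cj x) (z, u, p)"
    using assms l by (simp add: weighted_degree_def)
qed

lemma solves_unique:
  assumes x: "solves \<beta> x" "weighted_degree (int (2 * n + 1)) (val x)" and \<omega>: "\<omega> * \<omega> = \<beta>" "\<omega> \<noteq> 0"
  obtains c where "x = cst c * flow \<omega> n"
proof -
  let ?A = "flow \<omega> n"
  obtain c where c: "\<And>k z u. val (du k x) (z, u, \<lambda>_. 0) = (if int (k + 1) = int (2 * n + 1) then c else 0)"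
    by (rule solves_linear[OF x]) auto
  \<comment> \<open>No k + 1 equals a negative number, so x has no linear part in the conjugate
    variables.\<close>
  obtain c' where "\<And>k z u. val (du k (cj x)) (z, u, \<lambda>_. 0) = (if int (k + 1) = - int (2 * n + 1) then c' else 0)"
    by (rule solves_linear[OF solves_cj[OF x(1)] weighted_cj[OF x(2)]]) auto
  then have c': "ev0 (du k (cj x))" for k by (simp add: ev0_def)
  \<comment> \<open>The flow has linear part \<omega> u_{2n}, hence the division by \<omega>: this
    multiple cancels the linear part of x.\<close>
  define y where "y = x - cst (c / \<omega>) * ?A"
  have y: "solves \<beta> y" unfolding y_def by (intro solves_lincomb x solves_flow \<omega>)
  have "ev0 (du k ?A - cst \<omega> * du k (coord (2 * n)))" for k
    using flow_linear[of \<omega> n] by (simp add: numeral_2_eq_2 wd.simps)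
  then have A: "val (du k ?A) (z, u, \<lambda>_. 0) = (if k = 2 * n then \<omega> else 0)" for k z u
    by (auto simp: ev0_def wd_coord split: if_splits)
  have "ev0 (du k y)" for k
    using \<omega>(2) by (auto simp: ev0_def y_def wd.simps c A)
  then have 1: "vanish 2 y" using solves_ev0[OF y] by (simp add: numeral_2_eq_2)
  have "du k (cj ?A) = 0" for k
    using homog_const(4)[OF homog_flow] by (simp add: du_cj hol_def)
  then have "ev0 (du k (cj y))" for k
    using c' by (simp add: y_def wd.simps)
  then have 2: "vanish 2 (cj y)" using solves_ev0[OF y] by (simp add: numeral_2_eq_2)
  have "y = 0" by (rule solves_eq_0[OF y 1 2])
  then have "x = cst (c / \<omega>) * ?A" by (simp only: y_def right_minus_eq)
  then show thesis by (rule that)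
qed

lemma flow_ne_0:
  assumes "\<omega> \<noteq> 0"
  shows "flow \<omega> n \<noteq> 0"
proof
  assume "flow \<omega> n = 0"
  then have "ev0 (du (2 * n) (- (cst \<omega> * coord (2 * n))))"
    using flow_linear[of \<omega> n] by (simp add: numeral_2_eq_2)
  then show False using assms by (simp add: ev0_def wd.simps wd_coord)
qed

lemma dim_1:
  assumes "val a \<in> S" "a \<noteq> 0" "S \<subseteq> Collect smooth_jet" "\<And>x. val x \<in> S \<Longrightarrow> \<exists>c. x = cst c * a"
  shows "jet_fun.dim S = 1"
proof (rule jet_fun.dim_unique[of "{val a}"])
  have "val a \<noteq> 0" using assms(2) by (auto intro: sjet_eqI simp: zero_fun_def)
  then show "jet_fun.independent {val a}" by (simp add: jet_fun.dependent_single)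
  show "S \<subseteq> jet_fun.span {val a}"
  proof
    fix P assume P: "P \<in> S"
    then have "val (Sjet P) = P" using assms(3) Sjet_inverse by blast
    then obtain c where "P = val (cst c * a)" using assms(4)[of "Sjet P"] P by auto
    then have "P = jet_scale c (val a)" by (auto simp: jet_scale_def)
    then show "P \<in> jet_fun.span {val a}" by (simp add: jet_fun.span_base jet_fun.span_scale)
  qed
qed (use assms in auto)

theorem corollary9p3:
  fixes f :: "real \<Rightarrow> real" and \<beta> :: real
  assumes "smooth_real f"
    and "\<beta> \<noteq> 0"
    and "\<And>u. deriv (deriv f) u = \<beta> * f u"
    and "\<And>a b :: real. (\<And>u. a * f u + b * deriv f u = 0) \<Longrightarrow> a = 0 \<and> b = 0"
  shows "\<forall>d::int. odd d \<longrightarrow> jet_fun.dim (V f d) = 1"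
proof (intro allI impI)
  fix d :: int assume "odd d"
  have "f differentiable at u" "deriv f differentiable at u" for u
    using assms(1)[unfolded smooth_real_def, rule_format, of 0 u]
      assms(1)[unfolded smooth_real_def, rule_format, of 1 u] by simp_all
  then have 1: "(f has_real_derivative deriv f u) (at u)"
    and 2: "(deriv f has_real_derivative deriv (deriv f) u) (at u)" for u
    by (metis DERIV_imp_deriv real_differentiable_def)+
  interpret jet_equation f "deriv f" \<beta>
    by (rule jet_equation.intro[OF 1 2[unfolded assms(3)] assms(2,4)])
  \<comment> \<open>The root is taken in the complex numbers because \<beta> may be
    negative.\<close>
  define \<omega> where "\<omega> = csqrt (of_real \<beta>)"
  have \<omega>: "\<omega> * \<omega> = of_real \<beta>" "\<omega> \<noteq> 0"
    using assms(2) by (simp_all add: \<omega>_def flip: power2_eq_square)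
  have smooth: "V f d \<subseteq> Collect smooth_jet" by (auto simp: V_def)
  show "jet_fun.dim (V f d) = 1"
  proof (cases "d > 0")
    case True
    obtain b where b: "d = 2 * b + 1" using \<open>odd d\<close> by (rule oddE)
    define n where "n = nat b"
    have d: "d = int (2 * n + 1)" using True by (simp add: n_def b)
    show ?thesis
    proof (rule dim_1[OF _ flow_ne_0[OF \<omega>(2), of n] smooth])
      show "val (flow \<omega> n) \<in> V f d"
        unfolding val_mem_V_iff d by (intro conjI weighted_homog homog_flow solves_flow \<omega>)
      show "\<exists>c. x = cst c * flow \<omega> n" if "val x \<in> V f d" for x
        using that solves_unique[OF _ _ \<omega>] unfolding val_mem_V_iff d by metis
    qed
  next
    case False
    obtain b where b: "d = 2 * b + 1" using \<open>odd d\<close> by (rule oddE)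
    \<comment> \<open>From 2 b + 1 = -(2 n + 1); the conjugate flow then spans the space of weight
      d.\<close>
    define n where "n = nat (- b - 1)"
    have d: "d = - int (2 * n + 1)" using False by (simp add: n_def b)
    show ?thesis
    proof (rule dim_1[OF _ _ smooth])
      show "cj (flow \<omega> n) \<noteq> 0" using flow_ne_0[OF \<omega>(2)] by simp
      show "val (cj (flow \<omega> n)) \<in> V f d"
        unfolding val_mem_V_iff d by (intro conjI weighted_cj weighted_homog homog_flow solves_cj solves_flow \<omega>)
      show "\<exists>c. x = cst c * cj (flow \<omega> n)" if "val x \<in> V f d" for x
      proof -
        have x: "weighted_degree d (val x)" "solves \<beta> x"
          using that by (simp_all add: val_mem_V_iff)
        have w: "weighted_degree (int (2 * n + 1)) (val (cj x))"
          using weighted_cj[OF x(1)] unfolding d minus_minus .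
        obtain c where "cj x = cst c * flow \<omega> n"
          by (rule solves_unique[OF solves_cj[OF x(2)] w \<omega>])
        then have "cj (cj x) = cj (cst c * flow \<omega> n)" by (rule arg_cong)
        then have "x = cst (cnj c) * cj (flow \<omega> n)" by simp
        then show ?thesis ..
      qed
    qed
  qed
qed

end
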